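(* Let $A$ be a Young function with complementary function $\widetilde A$, let $\mathcal L$ be the Laplace transform, and consider the condition $$\int_0\log\frac1{A(\tau)}\,d\tau<\infty.\qquad(\ast)$$ Define $G_A,B_A:[0,\infty]\to[0,\infty]$ by $$G_A(t)=t\int_0^t\frac{\widetilde A(\tau)}{\tau^2}\,d\tau\quad\text{and}\quad B_A(t)=\frac1{G_A\left(\frac1t\right)}\quad\text{for }t\ge0.$$ If $A$ satisfies condition $(\ast)$, then $B_A$ is a quasi-convex function and the following statements are equivalent. (i) It holds that $\mathcal L\colon L^A(0,\infty)\to L^{B_A}(0,\infty)$; (ii) the space $L^{B_A}(0,\infty)$ is the smallest Orlicz space $L^B(0,\infty)$ such that $\mathcal L\colon L^A(0,\infty)\to L^B(0,\infty)$; (iii) there exists a smallest Orlicz space $L^B(0,\infty)$ such that $\mathcal L\colon L^A(0,\infty)\to L^B(0,\infty)$. Conversely, if condition $(\ast)$ fails, then there is no Orlicz space $L^B(0,\infty)$ such that $\mathcal L\colon L^A(0,\infty)\to L^B(0,\infty)$.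
   Context: A function $A:[0,\infty]\to[0,\infty]$ is quasi-convex if it is left-continuous, not identically zero or infinity on $(0,\infty]$, $A(0)=0$, and $t\mapsto A(t)/t$ is non-decreasing on $(0,\infty)$; it is a Young function if it is moreover convex on $[0,\infty]$. The complementary function of $A$ is $\widetilde A(t)=\sup\{\tau t-A(\tau):\tau>0\}$ for $t\in[0,\infty]$. The conventions $1/0=\infty$ and $1/\infty=0$ are used. For quasi-convex $A$, the Orlicz space $L^A(0,\infty)$ is the set of measurable $f$ on $(0,\infty)$ with $\|f\|_{L^A}=\inf\{\lambda>0:\int_0^\infty A(|f|/\lambda)\le1\}<\infty$; "Orlicz space" means a space of this form. The notation $\int_0 h<\infty$ means that the integral of $h$ converges near zero, that is, $\int_0^\varepsilon h<\infty$ for some $\varepsilon>0$; here $\log\frac1{A(\tau)}=\infty$ where $A(\tau)=0$. The Laplace transform is $\mathcal Lf(t)=\int_0^\infty f(\tau)e^{-t\tau}\,d\tau$ for $t>0$, whenever the integral exists. The notation $\mathcal L\colon L^A\to L^B$ means that $\mathcal L$ is defined on $L^A$ and there is $C>0$ with $\|\mathcal Lf\|_{L^B}\le C\|f\|_{L^A}$ for all $f\in L^A$. "Smallest" is with respect to inclusion: a smallest such space has the property and is contained in every Orlicz space with the property.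
   Formalization: "B_A is quasi-convex" fails for A(t)=t (B_A is not left-continuous at 1); proved instead: the left-continuous version of B_A is quasi-convex with the same norm, and B_A itself is quasi-convex exactly when G_A does not jump from a finite value to infinity at a finite point. *)

theory Defs
  imports "HOL-Analysis.Analysis"
begin

text \<open>Functions on \<open>[0,\<infinity>]\<close> are functions on \<^typ>\<open>ennreal\<close>. There
  \<open>1 / 0 = \<infinity>\<close>, \<open>1 / \<infinity> = 0\<close> and \<open>0 * \<infinity> = 0\<close>.\<close>

definition quasi_convex :: "(ennreal \<Rightarrow> ennreal) \<Rightarrow> bool" where
  "quasi_convex A \<longleftrightarrow>
     (\<forall>t>0. (A \<longlongrightarrow> A t) (at_left t)) \<and>
     \<not> (\<forall>t>0. A t = 0) \<and> \<not> (\<forall>t>0. A t = \<infinity>) \<and>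
     A 0 = 0 \<and>
     mono_on {0<..<\<infinity>} (\<lambda>t. A t / t)"

definition young_function :: "(ennreal \<Rightarrow> ennreal) \<Rightarrow> bool" where
  "young_function A \<longleftrightarrow>
     quasi_convex A \<and>
     (\<forall>s t. \<forall>u\<in>{0..1::real}.
        A (ennreal u * s + ennreal (1 - u) * t) \<le> ennreal u * A s + ennreal (1 - u) * A t)"

text \<open>The supremum runs over real \<open>\<tau>\<close>, so that \<open>\<infinity> - \<infinity>\<close> cannot arise from \<open>\<tau> = \<infinity>\<close>.
  Subtraction on \<^typ>\<open>ennreal\<close> is truncated at \<open>0\<close>; for a quasi-convex \<open>A\<close> this does not change
  the supremum, which is nonnegative because \<open>A \<tau>\<close> tends to \<open>0\<close> as \<open>\<tau>\<close> tends to \<open>0\<close>.\<close>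

definition complementary :: "(ennreal \<Rightarrow> ennreal) \<Rightarrow> ennreal \<Rightarrow> ennreal" where
  "complementary A t = (SUP \<tau>\<in>{0<..<\<infinity>}. \<tau> * t - A \<tau>)"

definition orlicz_norm :: "(ennreal \<Rightarrow> ennreal) \<Rightarrow> (real \<Rightarrow> real) \<Rightarrow> ennreal" where
  "orlicz_norm A f =
     Inf {ennreal l | l. 0 < l \<and> (\<integral>\<^sup>+x. A (ennreal (\<bar>f x\<bar> / l)) \<partial>lebesgue_on {0<..}) \<le> 1}"

text \<open>A function on \<open>(0,\<infinity>)\<close> is represented by any function on the reals extending it; the values
  outside \<open>(0,\<infinity>)\<close> play no role.\<close>

definition orlicz_space :: "(ennreal \<Rightarrow> ennreal) \<Rightarrow> (real \<Rightarrow> real) set" where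
  "orlicz_space A = {f \<in> borel_measurable (lebesgue_on {0<..}). orlicz_norm A f < \<infinity>}"

definition laplace :: "(real \<Rightarrow> real) \<Rightarrow> real \<Rightarrow> real" where
  "laplace f t = (LINT \<tau>:{0<..}|lebesgue. f \<tau> * exp (- (t * \<tau>)))"

definition laplace_bounded :: "(ennreal \<Rightarrow> ennreal) \<Rightarrow> (ennreal \<Rightarrow> ennreal) \<Rightarrow> bool" where
  "laplace_bounded A B \<longleftrightarrow>
     (\<forall>f\<in>orlicz_space A. \<forall>t>0. set_integrable lebesgue {0<..} (\<lambda>\<tau>. f \<tau> * exp (- (t * \<tau>)))) \<and>
     (\<exists>C>0. \<forall>f\<in>orlicz_space A. orlicz_norm B (laplace f) \<le> ennreal C * orlicz_norm A f)"

text \<open>\<open>B\<close> itself need not be quasi-convex here, but its space has to be an Orlicz space, that is,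
  to arise from some quasi-convex function.\<close>

definition smallest_laplace_target :: "(ennreal \<Rightarrow> ennreal) \<Rightarrow> (ennreal \<Rightarrow> ennreal) \<Rightarrow> bool" where
  "smallest_laplace_target A B \<longleftrightarrow>
     (\<exists>D. quasi_convex D \<and> orlicz_space D = orlicz_space B) \<and>
     laplace_bounded A B \<and>
     (\<forall>D. quasi_convex D \<longrightarrow> laplace_bounded A D \<longrightarrow> orlicz_space B \<subseteq> orlicz_space D)"

definition log_recip :: "ennreal \<Rightarrow> ereal" where
  "log_recip a = (if a = 0 then \<infinity> else if a = \<infinity> then - \<infinity> else ereal (ln (1 / enn2real a)))"

text \<open>\<^const>\<open>e2ennreal\<close> takes the positive part. A possibly negative integrand has integral less
  than \<open>\<infinity>\<close> exactly if its positive part has.\<close>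

definition converges_near_zero :: "(real \<Rightarrow> ereal) \<Rightarrow> bool" where
  "converges_near_zero h \<longleftrightarrow>
     (\<exists>\<epsilon>>0. (\<integral>\<^sup>+\<tau>\<in>{0<..<\<epsilon>}. e2ennreal (h \<tau>) \<partial>lborel) < \<infinity>)"

definition log_condition :: "(ennreal \<Rightarrow> ennreal) \<Rightarrow> bool" where
  "log_condition A \<longleftrightarrow> converges_near_zero (\<lambda>\<tau>. log_recip (A (ennreal \<tau>)))"

definition G_fun :: "(ennreal \<Rightarrow> ennreal) \<Rightarrow> ennreal \<Rightarrow> ennreal" where
  "G_fun A t =
     t * (\<integral>\<^sup>+\<tau>\<in>{\<tau>. 0 < \<tau> \<and> ennreal \<tau> < t}. complementary A (ennreal \<tau>) / (ennreal \<tau>)\<^sup>2 \<partial>lborel)"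

definition B_fun :: "(ennreal \<Rightarrow> ennreal) \<Rightarrow> ennreal \<Rightarrow> ennreal" where
  "B_fun A t = 1 / G_fun A (1 / t)"

text \<open>For a nondecreasing \<open>B\<close> with \<open>B 0 = 0\<close> this is the left limit at every \<open>t > 0\<close>, that is, the
  left-continuous representative of \<open>B\<close>. It is needed because \<open>B_fun A\<close> can fail to be
  left-continuous at one point: for \<open>A t = t\<close> the complementary function is \<open>0\<close> on \<open>[0,1]\<close> and
  \<open>\<infinity>\<close> on \<open>(1,\<infinity>]\<close>, hence \<open>B_fun A\<close> is \<open>0\<close> on \<open>[0,1)\<close> and \<open>\<infinity>\<close> on \<open>[1,\<infinity>]\<close>.\<close>

definition left_version :: "(ennreal \<Rightarrow> ennreal) \<Rightarrow> ennreal \<Rightarrow> ennreal" where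
  "left_version B t = (SUP s\<in>{..<t}. B s)"

end

theory Submission
  imports Defs
begin

text \<open>Write \<open>L\<close> for the Laplace transform, \<open>A*\<close> for the complementary function of \<open>A\<close>, and \<open>G\<close>, \<open>B\<close> for
\<open>G_fun A\<close> and \<open>B_fun A\<close>. Three facts carry the proof.

Every target is dominated by \<open>B\<close>. The operator \<open>L\<close> is symmetric, so the integral of \<open>L f\<close> over
\<open>(0, 1/R)\<close> is the integral of \<open>f\<close> against the transform of an indicator, a kernel of size
\<open>min (1/R) (1/s)\<close>. If \<open>L\<close> maps \<open>L\<^sup>A\<close> into \<open>L\<^sup>D\<close> and \<open>R \<le> D y\<close>, this integral is at most a multiple of
\<open>y/R\<close> on the unit ball of \<open>L\<^sup>A\<close>. By duality the kernel \<open>1/s\<close> on \<open>(R,\<infinity>)\<close> has \<open>A*\<close>-modular at most a constant after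
division by a multiple of \<open>y/R\<close>, and the substitution \<open>\<tau> = c/s\<close> turns this modular into an integral of
\<open>A* \<tau> / \<tau>\<^sup>2\<close>, that is, into \<open>G\<close>. The outcome is \<open>D y \<le> B (C y)\<close>, see \<open>laplace_target_le_B_fun\<close>. In particular
\<open>G\<close> is finite near zero as soon as a target exists, and a layer-cake argument shows that this is
the logarithmic condition (\<open>log_condition_iff_G_fun_finite\<close>). Both the negative statement for a failing condition
and the minimality of \<open>L\<^sup>B\<close> among all targets, provided it is one, follow.

Conversely, suppose that \<open>L\<close> is defined on \<open>L\<^sup>A\<close>; then every single value of \<open>B\<close> is attained by a target, up to a fixed dilation. If \<open>R \<le> B y\<close>, the same
computation read backwards bounds the integral of \<open>L f\<close> over \<open>(0, 1/R)\<close> by \<open>8 y / R\<close>. The transform of \<open>\<bar>f\<bar>\<close>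
is decreasing, so it exceeds \<open>8 y\<close> only inside that interval. Hence the function that vanishes up to
\<open>y\<close> and equals \<open>R x / y\<close> afterwards is a target, with a constant depending on neither \<open>y\<close>
nor \<open>R\<close>. Uniformity allows sums of such functions with weights \<open>2 ^ -k\<close>
(\<open>laplace_threshold_sum_estimate\<close>).

Finally, let \<open>D\<close> be a smallest target. If \<open>B x \<le> D (K x)\<close> failed for every \<open>K\<close>, points \<open>y\<^sub>k\<close>
at which \<open>B\<close> exceeds \<open>D (8 ^ (k + 1) y\<^sub>k)\<close> would give such a weighted sum whose space does not contain \<open>L\<^sup>D\<close>, because an
inclusion of Orlicz spaces forces domination up to a dilation (\<open>orlicz_space_subset_imp_dilate\<close>). So \<open>B\<close> is dominated by a target
and is itself one. Replacing \<open>B\<close> by its left-continuous version changes no norm.\<close>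

section \<open>Quasi-convex functions\<close>

lemma borel_measurable_mono_ennreal:
  fixes f :: "ennreal \<Rightarrow> ennreal"
  assumes "mono f"
  shows "f \<in> borel_measurable borel"
proof (rule borel_measurableI_greater)
  fix a
  define U where "U = {x. a < f x}"
  have up: "y \<in> U" if "x \<in> U" "x \<le> y" for x y
    using that monoD[OF assms, of x y] by (auto simp: U_def)
  have "U = {Inf U..} \<or> U = {Inf U<..}"
  proof (cases "Inf U \<in> U")
    case True
    then show ?thesis using up by (auto intro: Inf_lower)
  next
    case False
    have "x \<in> U" if "Inf U < x" for x
      using that up by (auto simp: Inf_less_iff)
    moreover have "Inf U < x" if "x \<in> U" for x
      using that False Inf_lower[OF that] by (metis order_le_less)
    ultimately show ?thesis by blast
  qed
  then have "U \<in> sets borel" by (metis atLeast_borel greaterThan_borel)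
  then show "{x \<in> space borel. a < f x} \<in> sets borel" by (simp add: U_def)
qed

lemma at_left_ennreal_nontrivial:
  fixes t :: ennreal
  assumes "t > 0"
  shows "at_left t \<noteq> bot"
proof
  assume "at_left t = bot"
  then have "\<forall>\<^sub>F x in at_left t. False" by (simp add: eventually_bot)
  then obtain b where "b < t" "\<forall>y>b. y < t \<longrightarrow> False"
    using assms by (subst (asm) eventually_at_left[of 0]) auto
  then show False using dense[of b t] by blast
qed

text \<open>For a monotone function the left limit at \<open>t\<close> is the supremum of the earlier values; in this form left continuity
is easiest to verify.\<close>
lemma mono_left_continuous:
  fixes A :: "ennreal \<Rightarrow> ennreal"
  assumes "mono A" "t > 0" "A t \<le> (SUP s\<in>{..<t}. A s)"
  shows "(A \<longlongrightarrow> A t) (at_left t)"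
proof (rule order_tendstoI)
  fix a assume "a < A t"
  then have "a < (SUP s\<in>{..<t}. A s)" using assms(3) by (rule less_le_trans)
  then obtain s where "s < t" "a < A s" by (auto simp: less_SUP_iff)
  then show "\<forall>\<^sub>F x in at_left t. a < A x"
    using monoD[OF assms(1), of s] by (subst eventually_at_left[of s]) (auto intro!: exI[of _ s] intro: less_le_trans)
next
  fix a assume "A t < a"
  then show "\<forall>\<^sub>F x in at_left t. A x < a"
    using assms(2) by (subst eventually_at_left[of 0])
      (auto intro!: exI[of _ 0] intro: le_less_trans[OF monoD[OF assms(1), of _ t]])
qed

text \<open>Monotonicity of \<open>A t / t\<close> is used throughout in the form \<open>c * A x \<le> A (c * x)\<close> for \<open>c \<ge> 1\<close>, which needs no division by
elements of \<^typ>\<open>ennreal\<close>.\<close>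
lemma quasi_convexI:
  assumes mono: "mono A" and zero: "A 0 = 0"
    and left: "\<And>t. t > 0 \<Longrightarrow> A t \<le> (SUP s\<in>{..<t}. A s)"
    and "\<exists>t. A t \<noteq> 0" and "\<exists>t>0. A t \<noteq> \<infinity>"
    and scale: "\<And>c x. 1 \<le> c \<Longrightarrow> 0 < x \<Longrightarrow> ennreal c * A (ennreal x) \<le> A (ennreal (c * x))"
  shows "quasi_convex A"
  unfolding quasi_convex_def
proof (intro conjI)
  show "\<forall>t>0. (A \<longlongrightarrow> A t) (at_left t)"
    using mono_left_continuous[OF mono] left by blast
  show "\<not> (\<forall>t>0. A t = 0)" using assms(4) zero by (metis not_gr_zero)
  show "\<not> (\<forall>t>0. A t = \<infinity>)" using assms(5) by blast
  show "A 0 = 0" by (fact zero)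
  show "mono_on {0<..<\<infinity>} (\<lambda>t. A t / t)"
  proof (rule mono_onI)
    fix s t :: ennreal assume st: "s \<in> {0<..<\<infinity>}" "t \<in> {0<..<\<infinity>}" "s \<le> t"
    then obtain x y where xy: "s = ennreal x" "t = ennreal y" "0 < x" "x \<le> y"
      by (cases s; cases t) (auto simp: top_unique)
    have "A s / s = ennreal (y / x) * A s * ennreal (1 / y)"
      using xy by (simp add: divide_ennreal_def inverse_ennreal mult.assoc mult.left_commute
          flip: ennreal_mult) (simp add: field_simps)
    also have "\<dots> \<le> A t * ennreal (1 / y)"
      using scale[of "y / x" x] xy by (intro mult_right_mono) auto
    finally show "A s / s \<le> A t / t"
      using xy by (simp add: divide_ennreal_def inverse_ennreal field_simps)
  qed
qed

lemma quasi_convex_ratio: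
  assumes "quasi_convex A" "0 < s" "s \<le> t" "t < \<infinity>"
  shows "A s / s \<le> A t / t"
proof -
  have "mono_on {0<..<\<infinity>} (\<lambda>t. A t / t)" using assms(1) by (simp add: quasi_convex_def)
  from mono_onD[OF this, of s t] show ?thesis using assms(2-) by simp
qed

text \<open>On \<open>(0,\<infinity>)\<close> the function is the product of the increasing functions \<open>A t / t\<close> and \<open>t\<close>; left continuity extends
monotonicity to the point \<open>\<infinity>\<close>.\<close>
lemma quasi_convex_mono:
  assumes "quasi_convex A"
  shows "mono A"
proof (rule monoI)
  fix s t :: ennreal assume "s \<le> t"
  have fin: "A s \<le> A t" if "0 < s" "s \<le> t" "t < \<infinity>" for s t
  proof -
    have "A s / s \<le> A t / t"
      using quasi_convex_ratio[OF assms] that by simp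
    then have "A s / s * s \<le> A t / t * s" by (rule mult_right_mono) simp
    also have "A s / s * s = A s" using that by (simp add: ennreal_divide_times)
    also have "A t / t * s \<le> A t / t * t" using that by (intro mult_left_mono) auto
    also have "\<dots> = A t" using that by (simp add: ennreal_divide_times)
    finally show ?thesis .
  qed
  consider "s = 0" | "s = t" | "0 < s" "s < t" "t = \<infinity>" | "0 < s" "s < t" "t < \<infinity>"
    using \<open>s \<le> t\<close> by (cases "s = 0"; cases "t = \<infinity>"; cases "s = t") (auto simp: less_top[symmetric] zero_less_iff_neq_zero)
  then show "A s \<le> A t"
  proof cases
    case 1 then show ?thesis using assms by (simp add: quasi_convex_def)
  next
    case 3
    have lim: "(A \<longlongrightarrow> A t) (at_left t)" using assms 3 by (simp add: quasi_convex_def)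
    have "at_left t \<noteq> bot" using 3 by (intro at_left_ennreal_nontrivial) simp
    moreover have "\<forall>\<^sub>F x in at_left t. A s \<le> A x"
      using 3 fin[of s] by (subst eventually_at_left[of s]) (auto intro!: exI[of _ s])
    ultimately show ?thesis using lim tendsto_lowerbound by blast
  qed (use fin in auto)
qed

lemma quasi_convex_scale:
  assumes "quasi_convex A" "1 \<le> c" "0 \<le> x"
  shows "ennreal c * A (ennreal x) \<le> A (ennreal (c * x))"
proof (cases "x = 0")
  case True then show ?thesis using assms by (simp add: quasi_convex_def)
next
  case False
  then have x: "0 < x" using assms by simp
  have "A (ennreal x) / ennreal x \<le> A (ennreal (c * x)) / ennreal (c * x)"
    using quasi_convex_ratio[OF assms(1)] assms(2) x by simp
  then have "A (ennreal x) / ennreal x * ennreal (c * x) \<le> A (ennreal (c * x)) / ennreal (c * x) * ennreal (c * x)"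
    by (rule mult_right_mono) simp
  also have "A (ennreal (c * x)) / ennreal (c * x) * ennreal (c * x) = A (ennreal (c * x))"
    using assms x by (simp add: ennreal_divide_times)
  also have "A (ennreal x) / ennreal x * ennreal (c * x) = ennreal c * A (ennreal x)"
    using assms x by (simp only: ennreal_divide_times divide_ennreal) (simp add: divide_ennreal mult.commute)
  finally show ?thesis .
qed

lemma quasi_convex_measurable:
  "quasi_convex A \<Longrightarrow> A \<in> borel_measurable borel"
  by (intro borel_measurable_mono_ennreal quasi_convex_mono)

lemma quasi_convex_zero: "quasi_convex A \<Longrightarrow> A 0 = 0"
  by (simp add: quasi_convex_def)

lemma quasi_convex_finite_somewhere:
  assumes "quasi_convex A"
  obtains x where "0 < x" "A (ennreal x) < \<infinity>"
proof -
  obtain t where t: "t > 0" "A t \<noteq> \<infinity>" using assms by (auto simp: quasi_convex_def)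
  then obtain s where "0 < s" "s < t" using dense by blast
  then obtain x where "s = ennreal x" "0 < x" by (cases s) auto
  moreover have "A s \<le> A t" using quasi_convex_mono[OF assms] \<open>s < t\<close> by (simp add: monoD)
  then have "A s < \<infinity>" using t(2) by (auto simp: less_top[symmetric] top_unique)
  ultimately show ?thesis using that by simp
qed

lemma quasi_convex_positive_somewhere:
  assumes "quasi_convex A"
  obtains x where "0 < x" "0 < A (ennreal x)"
proof -
  have "\<exists>x>0. A (ennreal x) \<noteq> 0"
  proof (rule ccontr)
    assume *: "\<not> ?thesis"
    have z: "A s = 0" if "s < \<infinity>" for s
      using that quasi_convex_zero[OF assms] * by (cases s; cases "s = 0") auto
    have "\<forall>\<^sub>F x in at_left \<infinity>. A x = 0"
      using z by (subst eventually_at_left[of 0]) (auto intro!: exI[of _ 0])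
    then have "(A \<longlongrightarrow> 0) (at_left \<infinity>)" by (rule tendsto_eventually)
    moreover have "(A \<longlongrightarrow> A \<infinity>) (at_left \<infinity>)" using assms by (simp add: quasi_convex_def)
    moreover have "at_left (\<infinity>::ennreal) \<noteq> bot" by (intro at_left_ennreal_nontrivial) simp
    ultimately have "A \<infinity> = 0" using tendsto_unique by blast
    then have "A t = 0" for t using z by (cases "t = \<infinity>") (auto simp: less_top)
    then show False using assms by (simp add: quasi_convex_def)
  qed
  then show ?thesis using that by (auto simp: zero_less_iff_neq_zero)
qed

section \<open>The Luxemburg norm and the left-continuous version\<close>

lemma orlicz_norm_le:
  assumes "0 < l" "(\<integral>\<^sup>+x. A (ennreal (\<bar>f x\<bar> / l)) \<partial>lebesgue_on {0<..}) \<le> 1"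
  shows "orlicz_norm A f \<le> ennreal l"
  unfolding orlicz_norm_def using assms by (intro Inf_lower) blast

text \<open>The infimum that defines the norm need not be attained in the absence of left continuity, hence the strict inequality.\<close>
lemma orlicz_norm_less_modular:
  assumes "mono A" "orlicz_norm A f < ennreal l"
  shows "(\<integral>\<^sup>+x. A (ennreal (\<bar>f x\<bar> / l)) \<partial>lebesgue_on {0<..}) \<le> 1"
proof -
  obtain k where k: "0 < k" "ennreal k < ennreal l"
      "(\<integral>\<^sup>+x. A (ennreal (\<bar>f x\<bar> / k)) \<partial>lebesgue_on {0<..}) \<le> 1"
    using assms(2) unfolding orlicz_norm_def Inf_less_iff by auto
  then have "k < l" by (simp add: ennreal_less_iff)
  have "(\<integral>\<^sup>+x. A (ennreal (\<bar>f x\<bar> / l)) \<partial>lebesgue_on {0<..}) \<le>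
      (\<integral>\<^sup>+x. A (ennreal (\<bar>f x\<bar> / k)) \<partial>lebesgue_on {0<..})"
    using k(1) \<open>k < l\<close> by (intro nn_integral_mono monoD[OF assms(1)] ennreal_leI divide_left_mono) auto
  also note k(3)
  finally show ?thesis .
qed

lemma le_orlicz_normI:
  assumes "0 < c"
    and "\<And>l. 0 < l \<Longrightarrow> (\<integral>\<^sup>+x. A (ennreal (\<bar>f x\<bar> / l)) \<partial>lebesgue_on {0<..}) \<le> 1 \<Longrightarrow> X \<le> ennreal (c * l)"
  shows "X \<le> ennreal c * orlicz_norm A f"
proof -
  have "X / ennreal c \<le> orlicz_norm A f"
    unfolding orlicz_norm_def
  proof (rule Inf_greatest, clarify)
    fix l :: real assume "0 < l" "(\<integral>\<^sup>+x. A (ennreal (\<bar>f x\<bar> / l)) \<partial>lebesgue_on {0<..}) \<le> 1"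
    then have "X / ennreal c \<le> ennreal (c * l) / ennreal c"
      using assms(2) by (intro divide_right_mono_ennreal) auto
    then show "X / ennreal c \<le> ennreal l" using assms(1) \<open>0 < l\<close> by (simp add: divide_ennreal)
  qed
  then have "X / ennreal c * ennreal c \<le> orlicz_norm A f * ennreal c" by (rule mult_right_mono) simp
  moreover have "X / ennreal c * ennreal c = X" using assms(1) by (simp add: ennreal_divide_times)
  ultimately show ?thesis by (simp add: mult.commute)
qed

text \<open>A pointwise bound up to dilation is a norm bound. All comparisons of targets with \<open>B_fun A\<close> below have this form; that an inclusion of
spaces conversely forces it is shown in \<open>orlicz_space_subset_imp_dilate\<close>.\<close>
lemma orlicz_norm_dilate:
  assumes "0 < c" "D 0 = 0" "\<And>x. 0 < x \<Longrightarrow> D (ennreal x) \<le> B (ennreal (c * x))"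
  shows "orlicz_norm D f \<le> ennreal c * orlicz_norm B f"
proof (rule le_orlicz_normI[OF assms(1)])
  fix l :: real assume l: "0 < l" "(\<integral>\<^sup>+x. B (ennreal (\<bar>f x\<bar> / l)) \<partial>lebesgue_on {0<..}) \<le> 1"
  have "D (ennreal (\<bar>f x\<bar> / (c * l))) \<le> B (ennreal (\<bar>f x\<bar> / l))" for x
    using assms(3)[of "\<bar>f x\<bar> / (c * l)"] assms(1,2) l(1) by (cases "f x = 0") (auto simp: field_simps)
  then have "(\<integral>\<^sup>+x. D (ennreal (\<bar>f x\<bar> / (c * l))) \<partial>lebesgue_on {0<..}) \<le> 1"
    by (intro order_trans[OF nn_integral_mono l(2)]) auto
  then show "orlicz_norm D f \<le> ennreal (c * l)" using assms(1) l(1) by (intro orlicz_norm_le) auto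
qed

lemma orlicz_space_dilate:
  assumes "0 < c" "D 0 = 0" "\<And>x. 0 < x \<Longrightarrow> D (ennreal x) \<le> B (ennreal (c * x))"
  shows "orlicz_space B \<subseteq> orlicz_space D"
proof
  fix f assume f: "f \<in> orlicz_space B"
  then have "ennreal c * orlicz_norm B f < \<infinity>"
    by (simp add: orlicz_space_def ennreal_mult_less_top)
  then have "orlicz_norm D f < \<infinity>" using orlicz_norm_dilate[OF assms, of f] by (rule le_less_trans[rotated])
  then show "f \<in> orlicz_space D" using f by (simp add: orlicz_space_def)
qed

lemma laplace_bounded_dilate:
  assumes "laplace_bounded A B"
    and "0 < c" "D 0 = 0" "\<And>x. 0 < x \<Longrightarrow> D (ennreal x) \<le> B (ennreal (c * x))"
  shows "laplace_bounded A D"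
proof -
  obtain C where C: "C > 0" "\<And>f. f \<in> orlicz_space A \<Longrightarrow> orlicz_norm B (laplace f) \<le> ennreal C * orlicz_norm A f"
    using assms(1) by (auto simp: laplace_bounded_def)
  have "orlicz_norm D (laplace f) \<le> ennreal (c * C) * orlicz_norm A f" if "f \<in> orlicz_space A" for f
  proof -
    have "orlicz_norm D (laplace f) \<le> ennreal c * orlicz_norm B (laplace f)"
      by (rule orlicz_norm_dilate[OF assms(2-4)])
    also have "\<dots> \<le> ennreal c * (ennreal C * orlicz_norm A f)" using C(2)[OF that] by (intro mult_left_mono) auto
    finally show ?thesis using assms(2) C(1) by (simp add: ennreal_mult mult.assoc)
  qed
  then show ?thesis using assms(1,2) C(1) unfolding laplace_bounded_def
    by (intro conjI exI[of _ "c * C"]) auto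
qed

lemma left_version_zero: "left_version B 0 = 0"
proof -
  have "{..<0::ennreal} = {}" by auto
  then show ?thesis by (simp add: left_version_def bot_ennreal)
qed

lemma left_version_le: "mono B \<Longrightarrow> left_version B t \<le> B t"
  by (auto simp: left_version_def intro!: SUP_least monoD[of B])

lemma le_left_version: "s < t \<Longrightarrow> B s \<le> left_version B t"
  by (auto simp: left_version_def intro!: SUP_upper)

lemma quasi_convex_left_version:
  assumes mono: "mono B" and zero: "B 0 = 0"
    and scale: "\<And>c x. 1 \<le> c \<Longrightarrow> 0 < x \<Longrightarrow> ennreal c * B (ennreal x) \<le> B (ennreal (c * x))"
    and pos: "0 < x\<^sub>0" "B (ennreal x\<^sub>0) \<noteq> 0" and fin: "0 < x\<^sub>1" "B (ennreal x\<^sub>1) \<noteq> \<infinity>"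
  shows "quasi_convex (left_version B)"
proof (rule quasi_convexI)
  show "mono (left_version B)"
    by (rule monoI) (auto simp: left_version_def intro!: SUP_subset_mono)
  show "left_version B 0 = 0" by (rule left_version_zero)
  show "left_version B t \<le> (SUP s\<in>{..<t}. left_version B s)" if "t > 0" for t
    unfolding left_version_def[of B t]
  proof (rule SUP_least)
    fix r assume "r \<in> {..<t}"
    then obtain s where "r < s" "s < t" using dense by blast
    then show "B r \<le> (SUP s\<in>{..<t}. left_version B s)"
      by (intro SUP_upper2[of s] le_left_version) auto
  qed
  have "B (ennreal x\<^sub>0) \<le> left_version B \<infinity>" by (rule le_left_version) simp
  then have "left_version B \<infinity> \<noteq> 0" using pos by auto
  then show "\<exists>t. left_version B t \<noteq> 0" ..
  have "left_version B (ennreal x\<^sub>1) \<le> B (ennreal x\<^sub>1)" by (rule left_version_le[OF mono])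
  then have "left_version B (ennreal x\<^sub>1) \<noteq> \<infinity>" using fin by (auto simp: top_unique)
  then show "\<exists>t>0. left_version B t \<noteq> \<infinity>" using fin by (intro exI[of _ "ennreal x\<^sub>1"]) auto
  show "ennreal c * left_version B (ennreal x) \<le> left_version B (ennreal (c * x))" if "1 \<le> c" "0 < x" for c x
    unfolding left_version_def[of B "ennreal x"] SUP_mult_left_ennreal
  proof (rule SUP_least)
    fix s assume s: "s \<in> {..<ennreal x}"
    show "ennreal c * B s \<le> left_version B (ennreal (c * x))"
    proof (cases "s = 0")
      case False
      then obtain y where y: "s = ennreal y" "0 < y" "y < x"
        using s that by (cases s) (auto simp: ennreal_less_iff)
      have "ennreal c * B s \<le> B (ennreal (c * y))" using scale y that by auto
      also have "\<dots> \<le> left_version B (ennreal (c * x))"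
        using y that by (intro le_left_version) (auto simp: ennreal_less_iff)
      finally show ?thesis .
    qed (simp add: zero)
  qed
qed

text \<open>Enlarging \<open>l\<close> to \<open>l + e\<close> moves \<open>\<bar>f x\<bar> / l\<close> strictly to the left wherever \<open>f x \<noteq> 0\<close>, and strictly to the left of a point \<open>B\<close> is at most
its left limit there.\<close>
lemma orlicz_norm_left_version:
  assumes "mono B" "B 0 = 0"
  shows "orlicz_norm (left_version B) f = orlicz_norm B f"
proof (rule antisym)
  show "orlicz_norm (left_version B) f \<le> orlicz_norm B f"
    using orlicz_norm_dilate[of 1 "left_version B" B f] left_version_le[OF assms(1)]
      left_version_zero[of B] by simp
  have "orlicz_norm B f \<le> ennreal 1 * orlicz_norm (left_version B) f"
  proof (rule le_orlicz_normI, simp)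
    fix l :: real
    assume l: "0 < l" "(\<integral>\<^sup>+x. left_version B (ennreal (\<bar>f x\<bar> / l)) \<partial>lebesgue_on {0<..}) \<le> 1"
    have "orlicz_norm B f \<le> ennreal l + ennreal e" if "0 < e" for e
    proof -
      have "B (ennreal (\<bar>f x\<bar> / (l + e))) \<le> left_version B (ennreal (\<bar>f x\<bar> / l))" for x
      proof (cases "f x = 0")
        case False
        then show ?thesis using that l(1)
          by (intro le_left_version) (auto simp: ennreal_less_iff intro!: divide_strict_left_mono)
      qed (simp add: assms)
      then have "(\<integral>\<^sup>+x. B (ennreal (\<bar>f x\<bar> / (l + e))) \<partial>lebesgue_on {0<..}) \<le> 1"
        by (intro order_trans[OF nn_integral_mono l(2)]) auto
      then have "orlicz_norm B f \<le> ennreal (l + e)" using that l(1) by (intro orlicz_norm_le) auto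
      then show ?thesis using that l(1) by simp
    qed
    then show "orlicz_norm B f \<le> ennreal (1 * l)" by (auto intro: ennreal_le_epsilon)
  qed
  then show "orlicz_norm B f \<le> orlicz_norm (left_version B) f" by simp
qed

section \<open>Reciprocals and an inversion of the half-line\<close>

lemma ennreal_inverse_inverse [simp]: "inverse (inverse (a::ennreal)) = a"
  using one_divide_one_divide_ennreal[of a] by (simp add: divide_ennreal_def)

lemma ennreal_inverse_antimono: "(a::ennreal) \<le> b \<Longrightarrow> inverse b \<le> inverse a"
proof (cases "a = 0 \<or> b = \<infinity>")
  case False
  assume "a \<le> b"
  then obtain x y where "a = ennreal x" "b = ennreal y" "0 < x" "x \<le> y"
    using False by (cases a; cases b) (auto simp: top_unique)
  then show ?thesis by (simp add: inverse_ennreal le_imp_inverse_le)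
qed auto

lemma ennreal_inverse_le_iff [simp]: "inverse b \<le> inverse a \<longleftrightarrow> (a::ennreal) \<le> b"
  using ennreal_inverse_antimono[of a b] ennreal_inverse_antimono[of "inverse b" "inverse a"] by auto

lemma ennreal_inverse_less_iff [simp]: "inverse b < inverse a \<longleftrightarrow> (a::ennreal) < b"
  by (simp flip: not_le)

lemma nn_integral_UN_incseq:
  assumes "f \<in> borel_measurable M" "incseq S" "range S \<subseteq> sets M"
  shows "(\<integral>\<^sup>+x\<in>(\<Union>n. S n). f x \<partial>M) = (SUP n. \<integral>\<^sup>+x\<in>S n. f x \<partial>M)"
proof -
  have "(SUP n. emeasure (density M f) (S n)) = emeasure (density M f) (\<Union>n. S n)"
    using assms(2,3) by (intro SUP_emeasure_incseq) auto
  moreover have "emeasure (density M f) (S n) = (\<integral>\<^sup>+x\<in>S n. f x \<partial>M)" for n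
    using assms by (intro emeasure_density) auto
  moreover have "emeasure (density M f) (\<Union>n. S n) = (\<integral>\<^sup>+x\<in>(\<Union>n. S n). f x \<partial>M)"
    using assms by (intro emeasure_density) auto
  ultimately show ?thesis by simp
qed

lemma greaterThan_zero_eq_UN:
  fixes c :: real
  assumes "0 < c"
  shows "{0<..} = (\<Union>n. {c / (real n + 2)..c * (real n + 2)})"
proof (intro equalityI subsetI)
  fix x :: real assume x: "x \<in> {0<..}"
  define n where "n = nat \<lceil>x / c + c / x\<rceil>"
  have pos: "0 < x / c" "0 < c / x" using x assms by auto
  have "x / c + c / x \<le> real n" unfolding n_def by (rule real_nat_ceiling_ge)
  then have "x / c \<le> real n + 2" "c / x \<le> real n + 2" using pos by linarith+
  then have "x \<in> {c / (real n + 2)..c * (real n + 2)}"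
    using x assms by (auto simp: field_simps)
  then show "x \<in> (\<Union>n. {c / (real n + 2)..c * (real n + 2)})" by blast
next
  fix x assume "x \<in> (\<Union>n. {c / (real n + 2)..c * (real n + 2)})"
  then obtain n where "c / (real n + 2) \<le> x" by auto
  moreover have "0 < c / (real n + 2)" using assms by simp
  ultimately show "x \<in> {0<..}" by simp
qed

lemma incseq_scaled_intervals:
  fixes c :: real
  assumes "0 < c"
  shows "incseq (\<lambda>n. {c / (real n + 2)..c * (real n + 2)})"
  using assms by (intro incseq_SucI) (auto simp: field_simps intro: order_trans)

text \<open>The change of variables is carried out for \<open>t\<close> in the compact intervals with end points \<open>1/(n+2)\<close> and \<open>n+2\<close>, which exhaust the half-line.\<close>
lemma nn_integral_inversion:
  fixes f :: "real \<Rightarrow> ennreal"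
  assumes f[measurable]: "f \<in> borel_measurable borel" and c: "0 < c"
  shows "(\<integral>\<^sup>+s\<in>{0<..}. f (c / s) \<partial>lborel) = (\<integral>\<^sup>+t\<in>{0<..}. f t * ennreal (c / t\<^sup>2) \<partial>lborel)"
proof -
  have part: "(\<integral>\<^sup>+s\<in>{c / (real n + 2)..c * (real n + 2)}. f (c / s) \<partial>lborel) =
      (\<integral>\<^sup>+t\<in>{1 / (real n + 2)..1 * (real n + 2)}. f t * ennreal (c / t\<^sup>2) \<partial>lborel)" for n
  proof -
    define a b where "a = 1 / (real n + 2)" and "b = real n + 2"
    have "1 < b" "a < 1" "0 < a" by (auto simp: a_def b_def)
    then have ab: "0 < a" "a < b" by linarith+
    \<comment> \<open>The increasing map \<open>t \<mapsto> - c / t\<close> is substituted, and then the sign is reversed.\<close>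
    have "(\<integral>\<^sup>+z. f (- (c / z)) * indicator {- (c / a)..- (c / b)} z \<partial>lborel) =
        (\<integral>\<^sup>+t. f (- (c / (- (c / t)))) * ennreal (c / t\<^sup>2) * indicator {a..b} t \<partial>lborel)"
      using ab c
      by (intro nn_integral_substitution_aux)
        (auto intro!: derivative_eq_intros continuous_intros simp: power2_eq_square field_simps)
    also have "\<dots> = (\<integral>\<^sup>+t\<in>{a..b}. f t * ennreal (c / t\<^sup>2) \<partial>lborel)"
      using ab c by (intro nn_integral_cong) (auto split: split_indicator)
    also have "(\<integral>\<^sup>+z. f (- (c / z)) * indicator {- (c / a)..- (c / b)} z \<partial>lborel) =
        (\<integral>\<^sup>+s. f (c / s) * indicator {c / b..c / a} s \<partial>lborel)"
      by (subst nn_integral_real_affine[where c = "-1" and t = 0])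
        (auto intro!: nn_integral_cong split: split_indicator)
    finally show ?thesis by (simp add: a_def b_def)
  qed
  have "(\<integral>\<^sup>+s\<in>{0<..}. f (c / s) \<partial>lborel) =
      (SUP n. \<integral>\<^sup>+s\<in>{c / (real n + 2)..c * (real n + 2)}. f (c / s) \<partial>lborel)"
    unfolding greaterThan_zero_eq_UN[OF c]
    by (intro nn_integral_UN_incseq incseq_scaled_intervals c) auto
  also have "\<dots> = (SUP n. \<integral>\<^sup>+t\<in>{1 / (real n + 2)..1 * (real n + 2)}. f t * ennreal (c / t\<^sup>2) \<partial>lborel)"
    by (simp only: part)
  also have "\<dots> = (\<integral>\<^sup>+t\<in>{0<..}. f t * ennreal (c / t\<^sup>2) \<partial>lborel)"
    unfolding greaterThan_zero_eq_UN[OF zero_less_one]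
    by (intro nn_integral_UN_incseq[symmetric] incseq_scaled_intervals) auto
  finally show ?thesis .
qed

section \<open>The complementary function and the function G\<close>

lemma mono_complementary: "mono (complementary A)"
  by (auto intro!: monoI SUP_mono' ennreal_minus_mono mult_left_mono simp: complementary_def)

lemma complementary_measurable [measurable]:
  "complementary A \<in> borel_measurable borel"
  by (intro borel_measurable_mono_ennreal mono_complementary)

lemma young_inequality:
  assumes "0 \<le> x"
  shows "ennreal x * t \<le> A (ennreal x) + complementary A t"
proof (cases "x = 0")
  case False
  then have "ennreal x * t - A (ennreal x) \<le> complementary A t"
    unfolding complementary_def using assms by (intro SUP_upper) auto
  then show ?thesis by (simp add: ennreal_minus_le_iff)
qed simp

text \<open>The nondecreasing factor \<open>G t / t\<close>; it increases with the domain of integration, which makes the monotonicity properties of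
\<open>G_fun\<close> immediate.\<close>
definition G_slope :: "(ennreal \<Rightarrow> ennreal) \<Rightarrow> ennreal \<Rightarrow> ennreal" where
  "G_slope A t = (\<integral>\<^sup>+\<tau>\<in>{\<tau>. 0 < \<tau> \<and> ennreal \<tau> < t}. complementary A (ennreal \<tau>) / (ennreal \<tau>)\<^sup>2 \<partial>lborel)"

lemma G_fun_eq_slope: "G_fun A t = t * G_slope A t"
  by (simp add: G_fun_def G_slope_def)

lemma G_slope_real:
  "0 \<le> u \<Longrightarrow> G_slope A (ennreal u) =
    (\<integral>\<^sup>+\<tau>\<in>{0<..<u}. complementary A (ennreal \<tau>) / (ennreal \<tau>)\<^sup>2 \<partial>lborel)"
  unfolding G_slope_def by (intro nn_integral_cong) (auto simp: ennreal_less_iff split: split_indicator)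

lemma G_slope_mono: "s \<le> t \<Longrightarrow> G_slope A s \<le> G_slope A t"
  unfolding G_slope_def
  by (intro nn_integral_mono mult_left_mono) (auto split: split_indicator)

lemma G_fun_mono: "s \<le> t \<Longrightarrow> G_fun A s \<le> G_fun A t"
  unfolding G_fun_eq_slope by (intro mult_mono G_slope_mono) auto

lemma G_fun_scale:
  assumes "1 \<le> c" "0 \<le> u"
  shows "ennreal c * G_fun A (ennreal u) \<le> G_fun A (ennreal (c * u))"
proof -
  have "ennreal c * G_fun A (ennreal u) = ennreal (c * u) * G_slope A (ennreal u)"
    using assms by (simp add: G_fun_eq_slope ennreal_mult mult.assoc)
  also have "\<dots> \<le> ennreal (c * u) * G_slope A (ennreal (c * u))"
    using assms mult_right_mono[of 1 c u] by (intro mult_left_mono G_slope_mono ennreal_leI) auto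
  finally show ?thesis by (simp add: G_fun_eq_slope)
qed

text \<open>Inverting the half-line turns the \<open>A*\<close>-modular of the kernel \<open>c / s\<close> on \<open>(r,\<infinity>)\<close> into an integral with weight
\<open>1 / \<tau>\<^sup>2\<close>. This is how \<open>G_fun\<close> enters the theory of the Laplace transform.\<close>
lemma nn_integral_complementary_tail:
  assumes "0 < c" "0 < r"
  shows "(\<integral>\<^sup>+s\<in>{r<..}. complementary A (ennreal (c / s)) \<partial>lborel) = ennreal c * G_slope A (ennreal (c / r))"
proof -
  let ?f = "\<lambda>t. complementary A (ennreal t) * indicator {0<..<c / r} t"
  have "(\<integral>\<^sup>+s\<in>{r<..}. complementary A (ennreal (c / s)) \<partial>lborel) = (\<integral>\<^sup>+s\<in>{0<..}. ?f (c / s) \<partial>lborel)"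
    using assms by (intro nn_integral_cong) (auto split: split_indicator simp: field_simps)
  also have "\<dots> = (\<integral>\<^sup>+t\<in>{0<..}. ?f t * ennreal (c / t\<^sup>2) \<partial>lborel)"
    by (rule nn_integral_inversion) (use assms in auto)
  also have "\<dots> = (\<integral>\<^sup>+t. ennreal c * (complementary A (ennreal t) / (ennreal t)\<^sup>2 * indicator {0<..<c / r} t) \<partial>lborel)"
  proof (rule nn_integral_cong)
    fix t :: real
    have "ennreal (c / t\<^sup>2) = ennreal c * inverse ((ennreal t)\<^sup>2)" if "0 < t"
      using that assms by (simp add: ennreal_power inverse_ennreal divide_inverse flip: ennreal_mult)
    then show "?f t * ennreal (c / t\<^sup>2) * indicator {0<..} t =
        ennreal c * (complementary A (ennreal t) / (ennreal t)\<^sup>2 * indicator {0<..<c / r} t)"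
      by (auto split: split_indicator simp: divide_ennreal_def mult_ac)
  qed
  also have "\<dots> = ennreal c * G_slope A (ennreal (c / r))"
    using assms by (subst nn_integral_cmult) (auto simp: G_slope_real)
  finally show ?thesis .
qed

text \<open>The part \<open>(u, 2u)\<close> of the domain of integration already suffices, since the integrand is at least \<open>A* u / (2u)\<^sup>2\<close> there.\<close>
lemma complementary_le_G_fun:
  assumes "0 < u"
  shows "complementary A (ennreal u) \<le> 2 * G_fun A (ennreal (2 * u))"
proof -
  let ?k = "complementary A (ennreal u)"
  have "ennreal u * (?k / (ennreal (2 * u))\<^sup>2) = (\<integral>\<^sup>+\<tau>\<in>{u<..<2 * u}. ?k / (ennreal (2 * u))\<^sup>2 \<partial>lborel)"
    using assms by (subst nn_integral_cmult_indicator) (auto simp: mult.commute)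
  also have "\<dots> \<le> G_slope A (ennreal (2 * u))"
  proof -
    have "?k / (ennreal (2 * u))\<^sup>2 \<le> complementary A (ennreal \<tau>) / (ennreal \<tau>)\<^sup>2" if "u < \<tau>" "\<tau> < 2 * u" for \<tau>
      unfolding divide_ennreal_def using that assms
      by (intro mult_mono monoD[OF mono_complementary] ennreal_inverse_antimono power_mono ennreal_leI) auto
    then show ?thesis using assms
      by (subst G_slope_real) (auto intro!: nn_integral_mono split: split_indicator)
  qed
  finally have "ennreal (4 * u) * (ennreal u * (?k / (ennreal (2 * u))\<^sup>2)) \<le> ennreal (4 * u) * G_slope A (ennreal (2 * u))"
    by (rule mult_left_mono) simp
  moreover have "ennreal (4 * u) * G_slope A (ennreal (2 * u)) = 2 * G_fun A (ennreal (2 * u))"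
    using assms by (simp add: G_fun_eq_slope ennreal_mult' mult.assoc[symmetric])
  moreover have "ennreal (4 * u) * (ennreal u * (?k / (ennreal (2 * u))\<^sup>2)) = ?k"
  proof -
    have "ennreal (4 * u) * (ennreal u * (?k / (ennreal (2 * u))\<^sup>2)) =
        ?k * ennreal (4 * u * u * inverse ((2 * u)\<^sup>2))"
      using assms by (simp add: divide_ennreal_def ennreal_power inverse_ennreal mult_ac flip: ennreal_mult)
        (simp add: ennreal_mult mult_ac)
    also have "4 * u * u * inverse ((2 * u)\<^sup>2) = 1" using assms by (simp add: power2_eq_square field_simps)
    finally show ?thesis by simp
  qed
  ultimately show ?thesis by simp
qed

section \<open>The function B\<close>

lemma B_fun_eq_inverse: "B_fun A t = inverse (G_fun A (inverse t))"
  by (simp add: B_fun_def divide_ennreal_def)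

lemma mono_B_fun: "mono (B_fun A)"
  by (intro monoI) (simp add: B_fun_eq_inverse G_fun_mono)

text \<open>In this form \<open>B_fun\<close> is used below: a lower bound on \<open>B\<close> is an upper bound on an integral of \<open>A* \<tau> / \<tau>\<^sup>2\<close>.\<close>
lemma le_B_fun_iff:
  assumes "0 < R" "0 < y"
  shows "ennreal R \<le> B_fun A (ennreal y) \<longleftrightarrow> G_fun A (ennreal (1 / y)) \<le> ennreal (1 / R)"
proof -
  have "ennreal R = inverse (ennreal (1 / R))" using assms by (simp add: inverse_ennreal)
  moreover have "inverse (ennreal y) = ennreal (1 / y)" using assms by (simp add: inverse_ennreal inverse_eq_divide)
  ultimately show ?thesis by (simp only: B_fun_eq_inverse ennreal_inverse_le_iff)
qed

lemma B_fun_scale: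
  assumes "1 \<le> c" "0 < x"
  shows "ennreal c * B_fun A (ennreal x) \<le> B_fun A (ennreal (c * x))"
proof -
  let ?g = "G_fun A (ennreal (1 / (c * x)))"
  have "ennreal c * ?g \<le> G_fun A (ennreal (1 / x))"
    using G_fun_scale[of c "1 / (c * x)" A] assms by simp
  then have "ennreal c * inverse (G_fun A (ennreal (1 / x))) \<le> ennreal c * inverse (ennreal c * ?g)"
    by (intro mult_left_mono) auto
  also have "\<dots> = ennreal c * inverse (ennreal c) * inverse ?g"
    using assms by (subst ennreal_inverse_mult') (auto simp: mult.assoc)
  also have "ennreal c * inverse (ennreal c) = 1"
    using assms by (simp add: inverse_ennreal flip: ennreal_mult)
  finally show ?thesis
    using assms by (simp add: B_fun_eq_inverse inverse_ennreal inverse_eq_divide)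
qed

lemma G_fun_positive_somewhere:
  assumes "quasi_convex A"
  obtains u where "0 < u" "0 < G_fun A (ennreal u)"
proof -
  obtain x where x: "0 < x" "A (ennreal x) < \<infinity>" using quasi_convex_finite_somewhere[OF assms] .
  then obtain a where a: "A (ennreal x) = ennreal a" "0 \<le> a" by (cases "A (ennreal x)") auto
  \<comment> \<open>With this slope, \<open>x * u - A x = 1\<close>.\<close>
  define u where "u = (a + 1) / x"
  have u: "0 < u" using x a by (simp add: u_def)
  have "ennreal x * ennreal u = ennreal (a + 1)" using x(1) u by (simp add: u_def flip: ennreal_mult)
  moreover have "ennreal x * ennreal u \<le> A (ennreal x) + complementary A (ennreal u)"
    using x by (intro young_inequality) simp
  ultimately have "complementary A (ennreal u) \<noteq> 0" using a by (auto simp: ennreal_plus[symmetric] simp del: ennreal_plus)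
  moreover have "complementary A (ennreal u) \<le> 2 * G_fun A (ennreal (2 * u))"
    by (rule complementary_le_G_fun[OF u])
  ultimately have "0 < G_fun A (ennreal (2 * u))"
    by (auto simp: zero_less_iff_neq_zero)
  then show ?thesis using u by (intro that[of "2 * u"]) auto
qed

lemma B_fun_zero:
  assumes "quasi_convex A"
  shows "B_fun A 0 = 0"
proof -
  obtain u where u: "0 < u" "0 < G_fun A (ennreal u)" by (rule G_fun_positive_somewhere[OF assms])
  then have "G_slope A (ennreal u) \<noteq> 0" by (auto simp: G_fun_eq_slope)
  moreover have "G_slope A (ennreal u) \<le> G_slope A \<infinity>" by (rule G_slope_mono) simp
  ultimately have "G_slope A \<infinity> \<noteq> 0" by auto
  then have "G_fun A \<infinity> = \<infinity>" by (simp add: G_fun_eq_slope)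
  then show ?thesis by (simp add: B_fun_eq_inverse)
qed

lemma B_fun_finite_somewhere:
  assumes "quasi_convex A"
  obtains x where "0 < x" "B_fun A (ennreal x) \<noteq> \<infinity>"
proof -
  obtain u where u: "0 < u" "0 < G_fun A (ennreal u)" by (rule G_fun_positive_somewhere[OF assms])
  then have "B_fun A (ennreal (1 / u)) \<noteq> \<infinity>" by (simp add: B_fun_eq_inverse inverse_ennreal inverse_eq_divide)
  then show ?thesis using u by (intro that[of "1 / u"]) auto
qed

lemma B_fun_positive_somewhere:
  assumes "0 < u" "G_fun A (ennreal u) < \<infinity>"
  shows "B_fun A (ennreal (1 / u)) \<noteq> 0"
  using assms by (simp add: B_fun_eq_inverse inverse_ennreal inverse_eq_divide)

lemma quasi_convex_left_version_B_fun:
  assumes "quasi_convex A" "0 < u" "G_fun A (ennreal u) < \<infinity>"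
  shows "quasi_convex (left_version (B_fun A))"
proof -
  obtain x where "0 < x" "B_fun A (ennreal x) \<noteq> \<infinity>" by (rule B_fun_finite_somewhere[OF assms(1)])
  then show ?thesis
    using assms(2) B_fun_positive_somewhere[OF assms(2,3)]
    by (intro quasi_convex_left_version[of _ "1 / u" x] mono_B_fun B_fun_zero[OF assms(1)] B_fun_scale) auto
qed

text \<open>Where \<open>G\<close> is finite strictly to the right, the measure with density \<open>A* \<tau> / \<tau>\<^sup>2\<close> is finite on an interval reaching beyond \<open>u\<close>, and continuity from
above applies.\<close>
lemma G_fun_right_continuous:
  assumes "0 \<le> u" "ennreal u < s" "G_fun A s < \<infinity>" "G_fun A (ennreal u) < b"
  obtains v where "u < v" "G_fun A (ennreal v) < b"
proof -
  obtain w where w: "ennreal u < ennreal w" "ennreal w < s"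
    using dense[OF assms(2)] by (metis ennreal_cases not_less_iff_gr_or_eq top.not_eq_extremum)
  then have uw: "u < w" using assms(1) by (simp add: ennreal_less_iff)
  have Gw: "G_fun A (ennreal w) < \<infinity>"
    using G_fun_mono[of "ennreal w" s A] w(2) assms(3) by (meson le_less_trans less_imp_le)
  then have Sw: "G_slope A (ennreal w) < \<infinity>"
    using uw assms(1) by (auto simp: G_fun_eq_slope ennreal_mult_less_top)
  define h where "h = (\<lambda>\<tau>. complementary A (ennreal \<tau>) / (ennreal \<tau>)\<^sup>2)"
  have [measurable]: "h \<in> borel_measurable borel" unfolding h_def by measurable
  define v where "v = (\<lambda>n. u + (w - u) / (real n + 1))"
  have v: "u < v n" "v n \<le> w" for n using uw by (auto simp: v_def field_simps intro: mult_right_mono)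
  have slope: "G_slope A (ennreal t) = emeasure (density lborel h) {0<..<t}" if "0 \<le> t" for t
    using that by (simp add: G_slope_real emeasure_density h_def)
  have lim_v: "v \<longlonglongrightarrow> u"
    using tendsto_add[OF tendsto_const[of u] tendsto_mult[OF tendsto_const[of "w - u"] LIMSEQ_inverse_real_of_nat]]
    by (simp add: v_def divide_inverse add.commute)
  have "(\<lambda>n. emeasure (density lborel h) {0<..<v n}) \<longlonglongrightarrow> emeasure (density lborel h) (\<Inter>n. {0<..<v n})"
  proof (rule Lim_emeasure_decseq)
    have "v (Suc n) \<le> v n" for n
      using uw by (auto simp: v_def intro!: divide_left_mono)
    then show "decseq (\<lambda>n. {0<..<v n})"
      by (intro decseq_SucI) (auto elim!: less_le_trans)
    show "emeasure (density lborel h) {0<..<v n} \<noteq> \<infinity>" for n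
      using Sw G_slope_mono[of "ennreal (v n)" "ennreal w" A] v[of n] assms(1)
      by (auto simp: slope[symmetric] top_unique intro: ennreal_leI)
  qed auto
  also have "(\<Inter>n. {0<..<v n}) = {0<..u}"
  proof (intro equalityI subsetI)
    fix x assume "x \<in> (\<Inter>n. {0<..<v n})"
    then have "0 < x" "\<And>n. x \<le> v n" by (auto intro: less_imp_le)
    then show "x \<in> {0<..u}" using LIMSEQ_le_const[OF lim_v, of x] by auto
  qed (use v in \<open>auto intro: le_less_trans\<close>)
  also have "emeasure (density lborel h) {0<..u} = G_slope A (ennreal u)"
  proof -
    have "emeasure (density lborel h) {0<..u} = (\<integral>\<^sup>+\<tau>\<in>{0<..<u}. h \<tau> \<partial>lborel)"
      unfolding emeasure_density[OF \<open>h \<in> borel_measurable borel\<close>[folded measurable_lborel2], of "{0<..u}", simplified]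
      using AE_lborel_singleton[of u] by (intro nn_integral_cong_AE) (auto split: split_indicator)
    then show ?thesis using assms(1) by (simp add: slope emeasure_density)
  qed
  finally have "(\<lambda>n. G_slope A (ennreal (v n))) \<longlonglongrightarrow> G_slope A (ennreal u)"
    using v assms(1) by (simp add: slope less_imp_le[OF le_less_trans])
  moreover have "G_slope A (ennreal u) \<noteq> \<infinity>"
    using Sw G_slope_mono[of "ennreal u" "ennreal w" A] w(1) by (auto simp: top_unique less_imp_le)
  moreover have "(\<lambda>n. ennreal (v n)) \<longlonglongrightarrow> ennreal u" by (intro tendsto_ennrealI lim_v)
  ultimately have "(\<lambda>n. G_fun A (ennreal (v n))) \<longlonglongrightarrow> G_fun A (ennreal u)"
    unfolding G_fun_eq_slope by (intro tendsto_mult_ennreal) auto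
  from order_tendstoD(2)[OF this assms(4)] obtain n where "G_fun A (ennreal (v n)) < b"
    by (auto simp: eventually_sequentially)
  then show ?thesis using v that by blast
qed

text \<open>Under \<open>t \<mapsto> 1 / t\<close> left continuity of \<open>B\<close> becomes right continuity of \<open>G\<close>, and the preceding lemma leaves only one way for it to
fail: a jump of \<open>G\<close> from a finite value to \<open>\<infinity>\<close>.\<close>
lemma quasi_convex_B_fun_iff:
  assumes A: "quasi_convex A" and fin: "0 < u\<^sub>0" "G_fun A (ennreal u\<^sub>0) < \<infinity>"
  shows "quasi_convex (B_fun A) \<longleftrightarrow> (\<forall>t<\<infinity>. G_fun A t < \<infinity> \<longrightarrow> (\<exists>s>t. G_fun A s < \<infinity>))"
proof (intro iffI allI impI)
  fix t :: ennreal assume B: "quasi_convex (B_fun A)" and t: "t < \<infinity>" "G_fun A t < \<infinity>"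
  then have pos: "0 < inverse t" "0 < B_fun A (inverse t)"
    by (auto simp: B_fun_eq_inverse zero_less_iff_neq_zero)
  then have "(B_fun A \<longlongrightarrow> B_fun A (inverse t)) (at_left (inverse t))"
    using B by (simp add: quasi_convex_def)
  then have "\<forall>\<^sub>F y in at_left (inverse t). 0 < B_fun A y"
    using pos(2) by (rule order_tendstoD)
  then obtain b where "b < inverse t" "\<forall>y>b. y < inverse t \<longrightarrow> 0 < B_fun A y"
    using pos(1) by (subst (asm) eventually_at_left[of 0]) auto
  then obtain y where "y < inverse t" "0 < B_fun A y" using dense by blast
  moreover from this have "t < inverse y"
    using ennreal_inverse_less_iff[of "inverse y" t] by (simp del: ennreal_inverse_less_iff)
  ultimately show "\<exists>s>t. G_fun A s < \<infinity>"
    by (intro exI[of _ "inverse y"]) (auto simp: B_fun_eq_inverse zero_less_iff_neq_zero less_top)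
next
  assume right: "\<forall>t<\<infinity>. G_fun A t < \<infinity> \<longrightarrow> (\<exists>s>t. G_fun A s < \<infinity>)"
  show "quasi_convex (B_fun A)"
  proof (rule quasi_convexI)
    fix t :: ennreal assume "t > 0"
    then obtain u where u: "inverse t = ennreal u" "0 \<le> u"
      by (cases "inverse t") auto
    show "B_fun A t \<le> (SUP s\<in>{..<t}. B_fun A s)"
    proof (rule dense_le)
      fix a assume a: "a < B_fun A t"
      then have "G_fun A (ennreal u) < inverse a"
        using ennreal_inverse_less_iff[of "inverse a" "G_fun A (ennreal u)"] u
        by (simp add: B_fun_eq_inverse)
      moreover from this have fin: "G_fun A (ennreal u) < \<infinity>" by (auto intro: less_le_trans)
      then obtain s where "ennreal u < s" "G_fun A s < \<infinity>" using right by (metis ennreal_less_top infinity_ennreal_def)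
      ultimately obtain v where v: "u < v" "G_fun A (ennreal v) < inverse a"
        using G_fun_right_continuous[OF u(2)] by blast
      have "inverse t < ennreal v" using u v by (simp add: ennreal_less_iff)
      then have "inverse (ennreal v) < t"
        using ennreal_inverse_less_iff[of "ennreal v" "inverse t"] by simp
      moreover have "a \<le> B_fun A (inverse (ennreal v))"
        using v(2) ennreal_inverse_le_iff[of "inverse a" "G_fun A (ennreal v)"]
        by (simp add: B_fun_eq_inverse less_imp_le)
      ultimately show "a \<le> (SUP s\<in>{..<t}. B_fun A s)" by (auto intro: SUP_upper2)
    qed
  next
    show "\<exists>t. B_fun A t \<noteq> 0" using B_fun_positive_somewhere[OF fin] by blast
    show "\<exists>t>0. B_fun A t \<noteq> \<infinity>"
      using B_fun_finite_somewhere[OF A] by (metis ennreal_less_zero_iff)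
  qed (use mono_B_fun B_fun_zero[OF A] B_fun_scale in auto)
qed

section \<open>The logarithmic condition\<close>

text \<open>The positive part of \<open>ln (1/b)\<close> is the integral of \<open>p dv / v\<close> over those \<open>v < 1\<close> with \<open>v ^ p > b\<close>. Writing the levels as powers avoids a change of variables: the two implications in
\<open>log_condition_iff_G_fun_finite\<close> use \<open>p = 1\<close> and \<open>p = 2\<close>.\<close>
lemma log_recip_layer_cake:
  fixes p :: nat
  assumes "0 < p"
  shows "e2ennreal (log_recip b) =
    (\<integral>\<^sup>+v\<in>{0<..<1}. ennreal (real p / v) * (if b < ennreal (v ^ p) then 1 else 0) \<partial>lborel)"
proof -
  let ?I = "\<lambda>b. \<integral>\<^sup>+v\<in>{0<..<1}. ennreal (real p / v) * (if b < ennreal (v ^ p) then 1 else 0) \<partial>lborel"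
  have main: "?I (ennreal r) = ennreal (- ln r)" if r: "0 < r" "r < 1" for r
  proof -
    define c where "c = root p r"
    have c: "0 < c" "c < 1" "c ^ p = r" using r assms by (auto simp: c_def)
    have less: "r < v ^ p \<longleftrightarrow> c < v" if "0 < v" for v
      using power_strict_mono[of c v p] power_less_imp_less_base[of c p v] c that assms by auto
    have "?I (ennreal r) = (\<integral>\<^sup>+v. ennreal (real p / v) * indicator {c..1} v \<partial>lborel)"
      using c
      by (intro nn_integral_cong_AE eventually_mono[OF eventually_conj[OF AE_lborel_singleton[of c] AE_lborel_singleton[of 1]]])
        (auto split: split_indicator simp: ennreal_less_iff less r less_imp_le)
    also have "\<dots> = ennreal (real p * ln 1 - real p * ln c)"
      using c by (intro nn_integral_FTC_Icc) (auto intro!: derivative_eq_intros)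
    also have "real p * ln 1 - real p * ln c = - ln r"
      using c by (auto simp: ln_realpow[symmetric])
    finally show ?thesis .
  qed
  consider "b = 0" | "b \<ge> 1" | r where "b = ennreal r" "0 < r" "r < 1"
    by (cases b) (force simp: not_le)+
  then show ?thesis
  proof cases
    case 1
    \<comment> \<open>The integrals for \<open>b = exp (- (n + 1))\<close> are lower bounds.\<close>
    have "ennreal (real n) \<le> ?I 0" for n
    proof -
      have "ennreal (real n) \<le> ennreal (- ln (exp (- (real n + 1))))" by (intro ennreal_leI) simp
      also have "\<dots> = ?I (ennreal (exp (- (real n + 1))))" by (rule main[symmetric]) auto
      also have "\<dots> \<le> ?I 0"
        by (intro nn_integral_mono mult_right_mono mult_left_mono)
          (auto simp del: ennreal_less_zero_iff intro: le_less_trans[OF zero_le])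
      finally show ?thesis .
    qed
    note large = this
    have "?I 0 = \<infinity>"
    proof (rule ccontr)
      assume "?I 0 \<noteq> \<infinity>"
      then have "?I 0 < top" by (simp add: less_top)
      then obtain n where "?I 0 < of_nat n" using ennreal_Ex_less_of_nat by blast
      with large[of n] show False by (simp add: ennreal_of_nat_eq_real_of_nat leD)
    qed
    then show ?thesis using 1 by (simp add: log_recip_def)
  next
    case 2
    have "e2ennreal (log_recip b) = 0"
    proof (cases b)
      case (real r)
      with 2 have "1 \<le> r" by simp
      then show ?thesis using real by (auto simp: log_recip_def ln_div ennreal_neg)
    next
      case top then show ?thesis by (simp add: log_recip_def e2ennreal_neg)
    qed
    moreover have "ennreal (v ^ p) \<le> b" if "0 < v" "v < 1" for v
      using 2 power_le_one[of v p] that by (intro order_trans[OF _ 2]) simp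
    then have "?I b = (\<integral>\<^sup>+(v::real). 0 \<partial>lborel)"
      by (intro nn_integral_cong) (auto split: split_indicator simp: not_less[symmetric])
    ultimately show ?thesis by simp
  next
    case 3
    then have "log_recip b = ereal (- ln r)" by (simp add: log_recip_def ln_div)
    then show ?thesis using 3 main by simp
  qed
qed

lemma nn_integral_log_recip:
  fixes p :: nat
  assumes "0 < p" and [measurable]: "A \<in> borel_measurable borel"
  shows "(\<integral>\<^sup>+\<tau>\<in>{0<..<\<delta>}. e2ennreal (log_recip (A (ennreal \<tau>))) \<partial>lborel) =
    (\<integral>\<^sup>+v\<in>{0<..<1}. ennreal (real p / v) *
        emeasure lborel {\<tau>\<in>{0<..<\<delta>}. A (ennreal \<tau>) < ennreal (v ^ p)} \<partial>lborel)"
proof -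
  let ?f = "\<lambda>\<tau> v. ennreal (real p / v) * indicator {0<..<1} v *
      (indicator {0<..<\<delta>} \<tau> * (if A (ennreal \<tau>) < ennreal (v ^ p) then 1 else 0))"
  have "(\<integral>\<^sup>+\<tau>\<in>{0<..<\<delta>}. e2ennreal (log_recip (A (ennreal \<tau>))) \<partial>lborel) = (\<integral>\<^sup>+\<tau>. \<integral>\<^sup>+v. ?f \<tau> v \<partial>lborel \<partial>lborel)"
    unfolding log_recip_layer_cake[OF assms(1)]
    by (intro nn_integral_cong) (auto split: split_indicator simp: mult_ac)
  also have "\<dots> = (\<integral>\<^sup>+v. \<integral>\<^sup>+\<tau>. ?f \<tau> v \<partial>lborel \<partial>lborel)"
    by (rule lborel_pair.Fubini') measurable
  also have "\<dots> = (\<integral>\<^sup>+v\<in>{0<..<1}. ennreal (real p / v) *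
        emeasure lborel {\<tau>\<in>{0<..<\<delta>}. A (ennreal \<tau>) < ennreal (v ^ p)} \<partial>lborel)"
  proof (rule nn_integral_cong)
    fix v :: real
    have "(\<integral>\<^sup>+\<tau>. ?f \<tau> v \<partial>lborel) = ennreal (real p / v) * indicator {0<..<1} v *
        (\<integral>\<^sup>+\<tau>. indicator {0<..<\<delta>} \<tau> * (if A (ennreal \<tau>) < ennreal (v ^ p) then 1 else 0) \<partial>lborel)"
      by (rule nn_integral_cmult) measurable
    also have "(\<integral>\<^sup>+\<tau>. indicator {0<..<\<delta>} \<tau> * (if A (ennreal \<tau>) < ennreal (v ^ p) then 1 else 0) \<partial>lborel) =
        (\<integral>\<^sup>+\<tau>. indicator {\<tau>\<in>{0<..<\<delta>}. A (ennreal \<tau>) < ennreal (v ^ p)} \<tau> \<partial>lborel)"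
      by (intro nn_integral_cong) (auto split: split_indicator)
    also have "\<dots> = emeasure lborel {\<tau>\<in>{0<..<\<delta>}. A (ennreal \<tau>) < ennreal (v ^ p)}"
      by (rule nn_integral_indicator) measurable
    finally show "(\<integral>\<^sup>+\<tau>. ?f \<tau> v \<partial>lborel) = ennreal (real p / v) *
        emeasure lborel {\<tau>\<in>{0<..<\<delta>}. A (ennreal \<tau>) < ennreal (v ^ p)} * indicator {0<..<1} v"
      by (simp add: mult_ac)
  qed
  finally show ?thesis .
qed

text \<open>If \<open>A \<tau> < v\<^sup>2\<close>, then Young's inequality gives \<open>\<tau> v \<le> v\<^sup>2 + A* v\<close>. The level \<open>v\<^sup>2\<close> is chosen so that division by \<open>v\<close> leaves the harmless term
\<open>v\<close>.\<close>
lemma sublevel_measure_le_complementary: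
  assumes "0 < v"
  shows "emeasure lborel {\<tau>\<in>{0<..<\<delta>}. A (ennreal \<tau>) < ennreal (v ^ 2)} \<le>
    complementary A (ennreal v) / ennreal v + ennreal v"
proof (cases "complementary A (ennreal v)")
  case (real k)
  have "{\<tau>\<in>{0<..<\<delta>}. A (ennreal \<tau>) < ennreal (v ^ 2)} \<subseteq> {0..k / v + v}"
  proof (clarify)
    fix \<tau> assume \<tau>: "\<tau> \<in> {0<..<\<delta>}" "A (ennreal \<tau>) < ennreal (v ^ 2)"
    have "ennreal \<tau> * ennreal v \<le> A (ennreal \<tau>) + complementary A (ennreal v)"
      using \<tau> by (intro young_inequality) auto
    also have "\<dots> \<le> ennreal (v ^ 2) + ennreal k" using \<tau> real by (intro add_mono) auto
    finally have "\<tau> * v \<le> v ^ 2 + k" using \<tau> real assms by (simp flip: ennreal_mult ennreal_plus)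
    then show "\<tau> \<in> {0..k / v + v}" using \<tau> assms by (simp add: field_simps power2_eq_square)
  qed
  then have "emeasure lborel {\<tau>\<in>{0<..<\<delta>}. A (ennreal \<tau>) < ennreal (v ^ 2)} \<le> emeasure lborel {0..k / v + v}"
    by (intro emeasure_mono) auto
  also have "\<dots> = complementary A (ennreal v) / ennreal v + ennreal v"
    using real assms by (simp add: divide_ennreal)
  finally show ?thesis .
qed (use assms in \<open>simp add: ennreal_top_divide\<close>)

text \<open>Only those \<open>\<tau>\<close> with \<open>A \<tau> < \<tau> u\<close> contribute to \<open>A* u\<close>. By quasi-convexity they form an initial interval, which the slope condition confines to
\<open>(0,\<delta>)\<close>; so \<open>\<tau>\<close> is at most its length, and on it \<open>A \<tau> < u\<close> because \<open>\<delta> \<le> 1\<close>.\<close>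
lemma complementary_le_sublevel_measure:
  assumes A: "quasi_convex A" and u: "0 < u" "u < u\<^sub>0" and \<delta>: "0 < \<delta>" "\<delta> \<le> 1"
    and slope: "ennreal (u\<^sub>0 * \<delta>) \<le> A (ennreal \<delta>)"
  shows "complementary A (ennreal u) \<le>
    ennreal u * emeasure lborel {\<tau>\<in>{0<..<\<delta>}. A (ennreal \<tau>) < ennreal u}"
  unfolding complementary_def
proof (rule SUP_least)
  fix \<tau> :: ennreal assume "\<tau> \<in> {0<..<\<infinity>}"
  then obtain t where t: "\<tau> = ennreal t" "0 < t" by (cases \<tau>) auto
  have [measurable]: "A \<in> borel_measurable borel" by (rule quasi_convex_measurable[OF A])
  show "\<tau> * ennreal u - A \<tau> \<le> ennreal u * emeasure lborel {\<tau>\<in>{0<..<\<delta>}. A (ennreal \<tau>) < ennreal u}"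
  proof (cases "A \<tau> < \<tau> * ennreal u")
    case True
    have small: "A (ennreal s) < ennreal (s * u)" if "0 < s" "s \<le> t" for s
    proof (rule ccontr)
      assume "\<not> ?thesis"
      then have "ennreal (t / s) * ennreal (s * u) \<le> ennreal (t / s) * A (ennreal s)"
        by (intro mult_left_mono) auto
      also have "\<dots> \<le> A (ennreal (t / s * s))" using that by (intro quasi_convex_scale A) auto
      finally have "ennreal (t * u) \<le> A \<tau>" using that t u by (simp flip: ennreal_mult)
      then show False using True t u by (simp add: ennreal_mult leD)
    qed
    have "t < \<delta>"
    proof (rule ccontr)
      assume "\<not> t < \<delta>"
      then have "A (ennreal \<delta>) < ennreal (\<delta> * u)" using \<delta> by (intro small) auto
      also have "\<dots> \<le> ennreal (u\<^sub>0 * \<delta>)" using u \<delta> by (intro ennreal_leI) (simp add: mult.commute)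
      finally show False using slope by simp
    qed
    have "{0<..t} \<subseteq> {\<tau>\<in>{0<..<\<delta>}. A (ennreal \<tau>) < ennreal u}"
    proof
      fix s assume s: "s \<in> {0<..t}"
      then have "s * u \<le> u" using \<open>t < \<delta>\<close> \<delta> u by (simp add: mult_left_le_one_le)
      then have "A (ennreal s) < ennreal u" using small[of s] s by (auto intro: less_le_trans ennreal_leI)
      then show "s \<in> {\<tau>\<in>{0<..<\<delta>}. A (ennreal \<tau>) < ennreal u}" using s \<open>t < \<delta>\<close> by auto
    qed
    then have "emeasure lborel {0<..t} \<le> emeasure lborel {\<tau>\<in>{0<..<\<delta>}. A (ennreal \<tau>) < ennreal u}"
      by (intro emeasure_mono) auto
    moreover have "\<tau> * ennreal u - A \<tau> \<le> ennreal u * emeasure lborel {0<..t}"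
      using t by (simp add: mult.commute)
    ultimately show ?thesis by (meson mult_left_mono order_trans zero_le)
  qed (simp add: diff_eq_0_ennreal not_less ennreal_mult_less_top t)
qed

text \<open>Both sides are weighted integrals over levels: the logarithmic integral is \<open>\<integral> p m(v\<^sup>p) dv / v\<close>, where \<open>m(a)\<close> is the measure of \<open>{A < a}\<close> near zero, and
\<open>G t / t\<close> is the integral of \<open>A* v / v\<^sup>2\<close>. The two preceding lemmas compare \<open>m\<close> with \<open>A* v / v\<close> in both directions.\<close>
lemma log_condition_iff_G_fun_finite:
  assumes A: "quasi_convex A"
  shows "log_condition A \<longleftrightarrow> (\<exists>u>0. G_fun A (ennreal u) < \<infinity>)"
proof
  have [measurable]: "A \<in> borel_measurable borel" by (rule quasi_convex_measurable[OF A])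
  {
    assume "log_condition A"
    then obtain \<epsilon> where \<epsilon>: "0 < \<epsilon>" "(\<integral>\<^sup>+\<tau>\<in>{0<..<\<epsilon>}. e2ennreal (log_recip (A (ennreal \<tau>))) \<partial>lborel) < \<infinity>"
      by (auto simp: log_condition_def converges_near_zero_def)
    define \<delta> where "\<delta> = min \<epsilon> 1"
    have \<delta>: "0 < \<delta>" "\<delta> \<le> 1" "\<delta> \<le> \<epsilon>" using \<epsilon> by (auto simp: \<delta>_def)
    have "A (ennreal \<delta>) \<noteq> 0"
    proof
      assume "A (ennreal \<delta>) = 0"
      then have zero: "A (ennreal \<tau>) = 0" if "\<tau> < \<delta>" for \<tau>
        using monoD[OF quasi_convex_mono[OF A], of "ennreal \<tau>" "ennreal \<delta>"] that by (simp add: ennreal_leI)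
      have "\<infinity> = (\<integral>\<^sup>+\<tau>. \<infinity> * indicator {0<..<\<delta>} \<tau> \<partial>lborel)"
        using \<delta> by (subst nn_integral_cmult_indicator) (auto simp: ennreal_top_mult)
      also have "\<dots> \<le> (\<integral>\<^sup>+\<tau>\<in>{0<..<\<epsilon>}. e2ennreal (log_recip (A (ennreal \<tau>))) \<partial>lborel)"
        using \<delta> zero by (intro nn_integral_mono) (auto split: split_indicator simp: log_recip_def)
      finally show False using \<epsilon> by simp
    qed
    \<comment> \<open>The slope of a line below \<open>A\<close> on \<open>[\<delta>,\<infinity>)\<close>.\<close>
    obtain u where u: "0 < u" "u \<le> 1" "ennreal (u * \<delta>) \<le> A (ennreal \<delta>)"
    proof (cases "A (ennreal \<delta>)")
      case (real a)
      then have "0 < a" using \<open>A (ennreal \<delta>) \<noteq> 0\<close> by (cases "a = 0") auto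
      then show ?thesis using real \<delta> by (intro that[of "min 1 (a / \<delta>)"]) (auto simp: field_simps min_def intro!: ennreal_leI)
    next
      case top then show ?thesis by (intro that[of 1]) auto
    qed
    have "G_slope A (ennreal u) \<le> (\<integral>\<^sup>+v\<in>{0<..<1}. ennreal (real 1 / v) *
        emeasure lborel {\<tau>\<in>{0<..<\<delta>}. A (ennreal \<tau>) < ennreal (v ^ 1)} \<partial>lborel)"
      unfolding G_slope_real[OF less_imp_le[OF u(1)]]
    proof (intro nn_integral_mono)
      fix v :: real
      let ?m = "emeasure lborel {\<tau>\<in>{0<..<\<delta>}. A (ennreal \<tau>) < ennreal v}"
      have "complementary A (ennreal v) / (ennreal v)\<^sup>2 \<le> ennreal (1 / v) * ?m" if v: "0 < v" "v < u"
      proof -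
        have "complementary A (ennreal v) / (ennreal v)\<^sup>2 \<le> ennreal v * ?m / (ennreal v)\<^sup>2"
          by (intro divide_right_mono_ennreal complementary_le_sublevel_measure[OF A v \<delta>(1,2) u(3)])
        also have "\<dots> = ennreal v * inverse (ennreal (v\<^sup>2)) * ?m"
          using v by (simp add: divide_ennreal_def ennreal_power mult_ac)
        also have "ennreal v * inverse (ennreal (v\<^sup>2)) = ennreal (1 / v)"
          using v by (simp add: inverse_ennreal flip: ennreal_mult) (simp add: power2_eq_square field_simps)
        finally show ?thesis .
      qed
      then show "complementary A (ennreal v) / (ennreal v)\<^sup>2 * indicator {0<..<u} v \<le>
          ennreal (real 1 / v) * emeasure lborel {\<tau>\<in>{0<..<\<delta>}. A (ennreal \<tau>) < ennreal (v ^ 1)} * indicator {0<..<1} v"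
        using u by (auto split: split_indicator)
    qed
    also have "\<dots> = (\<integral>\<^sup>+\<tau>\<in>{0<..<\<delta>}. e2ennreal (log_recip (A (ennreal \<tau>))) \<partial>lborel)"
      by (rule nn_integral_log_recip[symmetric]) auto
    also have "\<dots> \<le> (\<integral>\<^sup>+\<tau>\<in>{0<..<\<epsilon>}. e2ennreal (log_recip (A (ennreal \<tau>))) \<partial>lborel)"
      using \<delta> by (intro nn_integral_mono) (auto split: split_indicator)
    also note \<epsilon>(2)
    finally show "\<exists>u>0. G_fun A (ennreal u) < \<infinity>"
      using u by (intro exI[of _ u]) (auto simp: G_fun_eq_slope ennreal_mult_less_top)
  }
  {
    assume "\<exists>u>0. G_fun A (ennreal u) < \<infinity>"
    then obtain u where u: "0 < u" "G_fun A (ennreal u) < \<infinity>" by blast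
    then have slope: "G_slope A (ennreal u) < \<infinity>" by (auto simp: G_fun_eq_slope ennreal_mult_less_top)
    have "(\<integral>\<^sup>+\<tau>\<in>{0<..<1}. e2ennreal (log_recip (A (ennreal \<tau>))) \<partial>lborel) =
      (\<integral>\<^sup>+v\<in>{0<..<1}. ennreal (real 2 / v) *
        emeasure lborel {\<tau>\<in>{0<..<1}. A (ennreal \<tau>) < ennreal (v ^ 2)} \<partial>lborel)"
      by (rule nn_integral_log_recip) auto
    also have "\<dots> \<le> (\<integral>\<^sup>+v. 2 * (complementary A (ennreal v) / (ennreal v)\<^sup>2 * indicator {0<..<u} v) +
        ennreal (2 + 2 / u) * indicator {0<..<1} v \<partial>lborel)"
    proof (intro nn_integral_mono)
      fix v :: real
      let ?m = "emeasure lborel {\<tau>\<in>{0<..<1}. A (ennreal \<tau>) < ennreal (v ^ 2)}"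
      let ?q = "complementary A (ennreal v) / (ennreal v)\<^sup>2"
      have "ennreal (2 / v) * ?m \<le> 2 * (?q * indicator {0<..<u} v) + ennreal (2 + 2 / u)" if "0 < v"
      proof (cases "v < u")
        case True
        have "ennreal (2 / v) * ?m \<le> ennreal (2 / v) * (complementary A (ennreal v) / ennreal v + ennreal v)"
          by (intro mult_left_mono sublevel_measure_le_complementary that) auto
        also have "\<dots> = ennreal (2 / v) * inverse (ennreal v) * complementary A (ennreal v) + ennreal 2"
          using that by (simp add: distrib_left divide_ennreal_def mult_ac flip: ennreal_mult)
        also have "ennreal (2 / v) * inverse (ennreal v) = 2 * inverse ((ennreal v)\<^sup>2)"
          using that by (simp add: inverse_ennreal ennreal_power numeral_mult_ennreal flip: ennreal_mult)
            (simp add: power2_eq_square field_simps)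
        also have "2 * inverse ((ennreal v)\<^sup>2) * complementary A (ennreal v) + ennreal 2 \<le>
            2 * (?q * indicator {0<..<u} v) + ennreal (2 + 2 / u)"
          using True that u by (intro add_mono ennreal_leI) (auto simp: divide_ennreal_def mult_ac)
        finally show ?thesis .
      next
        case False
        have "?m \<le> emeasure lborel {0<..<1::real}" by (intro emeasure_mono) auto
        then have "ennreal (2 / v) * ?m \<le> ennreal (2 / v) * 1" by (intro mult_left_mono) auto
        also have "\<dots> \<le> ennreal (2 + 2 / u)"
        proof -
          have "2 / v \<le> 2 / u" using False u by (intro divide_left_mono) auto
          then show ?thesis by (simp add: ennreal_leI)
        qed
        finally show ?thesis by (simp add: add_increasing)
      qed
      then show "ennreal (real 2 / v) * ?m * indicator {0<..<1} v \<le>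
          2 * (?q * indicator {0<..<u} v) + ennreal (2 + 2 / u) * indicator {0<..<1} v"
        by (auto split: split_indicator)
    qed
    also have "\<dots> = 2 * G_slope A (ennreal u) + ennreal (2 + 2 / u)"
      using u by (simp add: nn_integral_add nn_integral_cmult G_slope_real nn_integral_cmult_indicator)
    also have "\<dots> < \<infinity>" using slope by (simp add: ennreal_mult_less_top)
    finally show "log_condition A"
      unfolding log_condition_def converges_near_zero_def by (intro exI[of _ 1]) auto
  }
qed

section \<open>Every target is dominated by B\<close>

lemma nn_integral_lebesgue_on_positive:
  "(\<integral>\<^sup>+x. f x \<partial>lebesgue_on {0::real<..}) = (\<integral>\<^sup>+x\<in>{0<..}. f x \<partial>lborel)"
  by (subst nn_integral_restrict_space) (auto simp: nn_integral_completion)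

lemma ennreal_laplace:
  assumes "\<And>x. 0 < x \<Longrightarrow> 0 \<le> f x"
    and "set_integrable lebesgue {0<..} (\<lambda>\<tau>. f \<tau> * exp (- (t * \<tau>)))"
  shows "ennreal (laplace f t) = (\<integral>\<^sup>+\<tau>\<in>{0<..}. ennreal (f \<tau> * exp (- (t * \<tau>))) \<partial>lborel)"
proof -
  have "(\<integral>\<^sup>+\<tau>. ennreal (indicator {0<..} \<tau> *\<^sub>R (f \<tau> * exp (- (t * \<tau>)))) \<partial>lebesgue) = ennreal (laplace f t)"
    unfolding laplace_def set_lebesgue_integral_def
    using assms by (intro nn_integral_eq_integral) (auto simp: set_integrable_def split: split_indicator)
  then show ?thesis
    by (simp add: nn_integral_completion ennreal_mult' mult.commute ennreal_indicator)
qed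

lemma nn_integral_exp_decay:
  assumes "0 < \<tau>" "0 < r"
  shows "(\<integral>\<^sup>+t\<in>{0<..<r}. ennreal (exp (- (t * \<tau>))) \<partial>lborel) = ennreal ((1 - exp (- (r * \<tau>))) / \<tau>)"
proof -
  have "(\<integral>\<^sup>+t\<in>{0<..<r}. ennreal (exp (- (t * \<tau>))) \<partial>lborel) =
      (\<integral>\<^sup>+t. ennreal (exp (- (t * \<tau>))) * indicator {0..r} t \<partial>lborel)"
    by (intro nn_integral_cong_AE eventually_mono[OF eventually_conj[OF AE_lborel_singleton[of 0] AE_lborel_singleton[of r]]])
      (auto split: split_indicator)
  also have "\<dots> = ennreal (- exp (- (r * \<tau>)) / \<tau> - (- exp (- (0 * \<tau>)) / \<tau>))"
    using assms by (intro nn_integral_FTC_Icc) (auto intro!: derivative_eq_intros)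
  also have "- exp (- (r * \<tau>)) / \<tau> - (- exp (- (0 * \<tau>)) / \<tau>) = (1 - exp (- (r * \<tau>))) / \<tau>"
    by (simp add: diff_divide_distrib)
  finally show ?thesis .
qed

text \<open>Symmetry of the Laplace transform, applied to \<open>\<phi>\<close> and the indicator of \<open>(0,r)\<close>, whose transform is \<open>(1 - exp (- r \<tau>)) / \<tau>\<close>.\<close>
lemma nn_integral_laplace_average:
  fixes \<phi> :: "real \<Rightarrow> ennreal"
  assumes [measurable]: "\<phi> \<in> borel_measurable borel" and "0 < r"
  shows "(\<integral>\<^sup>+t\<in>{0<..<r}. (\<integral>\<^sup>+\<tau>\<in>{0<..}. \<phi> \<tau> * ennreal (exp (- (t * \<tau>))) \<partial>lborel) \<partial>lborel) =
    (\<integral>\<^sup>+\<tau>\<in>{0<..}. \<phi> \<tau> * ennreal ((1 - exp (- (r * \<tau>))) / \<tau>) \<partial>lborel)"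
proof -
  have "(\<integral>\<^sup>+t\<in>{0<..<r}. (\<integral>\<^sup>+\<tau>\<in>{0<..}. \<phi> \<tau> * ennreal (exp (- (t * \<tau>))) \<partial>lborel) \<partial>lborel) =
      (\<integral>\<^sup>+t. \<integral>\<^sup>+\<tau>. \<phi> \<tau> * ennreal (exp (- (t * \<tau>))) * indicator {0<..} \<tau> * indicator {0<..<r} t \<partial>lborel \<partial>lborel)"
    by (intro nn_integral_cong nn_integral_multc[symmetric]) measurable
  also have "\<dots> = (\<integral>\<^sup>+\<tau>. \<integral>\<^sup>+t. \<phi> \<tau> * ennreal (exp (- (t * \<tau>))) * indicator {0<..} \<tau> * indicator {0<..<r} t \<partial>lborel \<partial>lborel)"
    by (rule lborel_pair.Fubini') measurable
  also have "\<dots> = (\<integral>\<^sup>+\<tau>\<in>{0<..}. \<phi> \<tau> * ennreal ((1 - exp (- (r * \<tau>))) / \<tau>) \<partial>lborel)"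
  proof (rule nn_integral_cong)
    fix \<tau> :: real
    have "(\<integral>\<^sup>+t. \<phi> \<tau> * ennreal (exp (- (t * \<tau>))) * indicator {0<..} \<tau> * indicator {0<..<r} t \<partial>lborel) =
        (\<integral>\<^sup>+t. (\<phi> \<tau> * indicator {0<..} \<tau>) * (ennreal (exp (- (t * \<tau>))) * indicator {0<..<r} t) \<partial>lborel)"
      by (intro nn_integral_cong) (simp add: mult_ac)
    also have "\<dots> = \<phi> \<tau> * indicator {0<..} \<tau> * (\<integral>\<^sup>+t\<in>{0<..<r}. ennreal (exp (- (t * \<tau>))) \<partial>lborel)"
      by (rule nn_integral_cmult) measurable
    also have "\<dots> = \<phi> \<tau> * ennreal ((1 - exp (- (r * \<tau>))) / \<tau>) * indicator {0<..} \<tau>"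
      using nn_integral_exp_decay[of \<tau> r] assms by (auto split: split_indicator)
    finally show "(\<integral>\<^sup>+t. \<phi> \<tau> * ennreal (exp (- (t * \<tau>))) * indicator {0<..} \<tau> * indicator {0<..<r} t \<partial>lborel) =
        \<phi> \<tau> * ennreal ((1 - exp (- (r * \<tau>))) / \<tau>) * indicator {0<..} \<tau>" .
  qed
  finally show ?thesis .
qed

text \<open>Above \<open>y\<close> the ratio \<open>D x / x\<close> is at least \<open>R / y\<close>.\<close>
lemma quasi_convex_affine_bound:
  assumes D: "quasi_convex D" and y: "0 < y" and R: "0 < R" "ennreal R \<le> D (ennreal y)" and x: "0 \<le> x"
  shows "ennreal x \<le> ennreal y + ennreal (y / R) * D (ennreal x)"
proof (cases "x \<le> y")
  case False
  have "ennreal x = ennreal (y / R) * (ennreal (x / y) * ennreal R)"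
    using y R x by (simp flip: ennreal_mult)
  also have "\<dots> \<le> ennreal (y / R) * (ennreal (x / y) * D (ennreal y))"
    by (intro mult_left_mono R) auto
  also have "\<dots> \<le> ennreal (y / R) * D (ennreal (x / y * y))"
    using False y by (intro mult_left_mono quasi_convex_scale D) auto
  finally show ?thesis using y by (simp add: add_increasing)
qed (simp add: ennreal_leI add_increasing2)

text \<open>A substitute for Hoelder's inequality against the indicator of \<open>(0, 1/R)\<close>: the affine bound is integrated over this interval of length \<open>1/R\<close>.\<close>
lemma quasi_convex_average_bound:
  assumes D: "quasi_convex D" and y: "0 < y" and R: "0 < R" "ennreal R \<le> D (ennreal y)"
    and [measurable]: "\<Phi> \<in> borel_measurable borel" and fin: "\<And>t. 0 < t \<Longrightarrow> \<Phi> t < \<infinity>"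
    and le1: "(\<integral>\<^sup>+t\<in>{0<..}. D (\<Phi> t) \<partial>lborel) \<le> 1"
  shows "(\<integral>\<^sup>+t\<in>{0<..<1 / R}. \<Phi> t \<partial>lborel) \<le> ennreal (2 * y / R)"
proof -
  have [measurable]: "D \<in> borel_measurable borel" by (rule quasi_convex_measurable[OF D])
  have "(\<integral>\<^sup>+t\<in>{0<..<1 / R}. \<Phi> t \<partial>lborel) \<le>
      (\<integral>\<^sup>+t. ennreal y * indicator {0<..<1 / R} t + ennreal (y / R) * (D (\<Phi> t) * indicator {0<..} t) \<partial>lborel)"
  proof (intro nn_integral_mono)
    fix t :: real
    show "\<Phi> t * indicator {0<..<1 / R} t \<le>
        ennreal y * indicator {0<..<1 / R} t + ennreal (y / R) * (D (\<Phi> t) * indicator {0<..} t)"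
    proof (cases "0 < t")
      case True
      then obtain x where "\<Phi> t = ennreal x" "0 \<le> x" using fin[OF True] by (cases "\<Phi> t") auto
      then show ?thesis
        using quasi_convex_affine_bound[OF D y R] by (auto split: split_indicator)
    qed auto
  qed
  also have "\<dots> = ennreal (y * (1 / R)) + ennreal (y / R) * (\<integral>\<^sup>+t\<in>{0<..}. D (\<Phi> t) \<partial>lborel)"
    using R y by (simp add: nn_integral_add nn_integral_cmult nn_integral_cmult_indicator flip: ennreal_mult)
  also have "\<dots> \<le> ennreal (y * (1 / R)) + ennreal (y / R) * 1"
    by (intro add_left_mono mult_left_mono le1) auto
  also have "\<dots> = ennreal (2 * y / R)" using R y by (simp flip: ennreal_plus)
  finally show ?thesis .
qed

text \<open>The average of \<open>L f\<close> over \<open>(0, 1/R)\<close> is bounded because \<open>D y \<ge> R\<close>. By symmetry it equals an integral of \<open>f\<close> against a kernel which on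
\<open>(R,\<infinity>)\<close> is at least \<open>1 / (2 \<tau>)\<close>.\<close>
lemma laplace_bounded_dual_estimate:
  assumes D: "quasi_convex D"
    and int: "\<And>f t. f \<in> orlicz_space A \<Longrightarrow> 0 < t \<Longrightarrow> set_integrable lebesgue {0<..} (\<lambda>\<tau>. f \<tau> * exp (- (t * \<tau>)))"
    and C: "0 < C" "\<And>f. f \<in> orlicz_space A \<Longrightarrow> orlicz_norm D (laplace f) \<le> ennreal C * orlicz_norm A f"
    and y: "0 < y" and R: "0 < R" "ennreal R \<le> D (ennreal y)"
    and f[measurable]: "f \<in> borel_measurable borel" and f0: "\<And>x. 0 \<le> f x"
    and le1: "(\<integral>\<^sup>+\<tau>\<in>{0<..}. A (ennreal (f \<tau>)) \<partial>lborel) \<le> 1"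
  shows "(\<integral>\<^sup>+\<tau>\<in>{R<..}. ennreal (f \<tau> / \<tau>) \<partial>lborel) \<le> ennreal (8 * C * y / R)"
proof -
  have norm: "orlicz_norm A f \<le> ennreal 1"
    using le1 f0 by (intro orlicz_norm_le) (auto simp: nn_integral_lebesgue_on_positive)
  have fA: "f \<in> orlicz_space A"
    unfolding orlicz_space_def
    using norm f by (auto intro!: measurable_restrict_space1 measurable_completion intro: le_less_trans)
  define \<Phi> where "\<Phi> t = (\<integral>\<^sup>+\<tau>\<in>{0<..}. ennreal (f \<tau>) * ennreal (exp (- (t * \<tau>))) \<partial>lborel)" for t
  have [measurable]: "\<Phi> \<in> borel_measurable borel" unfolding \<Phi>_def by measurable
  have lap: "\<Phi> t = ennreal (laplace f t)" if "0 < t" for t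
    using ennreal_laplace[OF f0 int[OF fA that]] f0 by (simp add: \<Phi>_def ennreal_mult)
  have lap0: "0 \<le> laplace f t" for t
    unfolding laplace_def set_lebesgue_integral_def using f0
    by (intro integral_nonneg_AE AE_I2) (auto split: split_indicator)
  have "orlicz_norm D (laplace f) \<le> ennreal C * ennreal 1"
    using C(2)[OF fA] norm by (meson mult_left_mono order_trans zero_le)
  also have "\<dots> < ennreal (2 * C)" using C(1) by (simp add: ennreal_less_iff)
  finally have "(\<integral>\<^sup>+t\<in>{0<..}. D (ennreal (\<bar>laplace f t\<bar> / (2 * C))) \<partial>lborel) \<le> 1"
    using orlicz_norm_less_modular[OF quasi_convex_mono[OF D]] by (simp add: nn_integral_lebesgue_on_positive)
  also have "(\<integral>\<^sup>+t\<in>{0<..}. D (ennreal (\<bar>laplace f t\<bar> / (2 * C))) \<partial>lborel) =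
      (\<integral>\<^sup>+t\<in>{0<..}. D (\<Phi> t / ennreal (2 * C)) \<partial>lborel)"
    using lap lap0 C(1) by (intro nn_integral_cong) (auto simp: divide_ennreal split: split_indicator)
  finally have "(\<integral>\<^sup>+t\<in>{0<..<1 / R}. \<Phi> t / ennreal (2 * C) \<partial>lborel) \<le> ennreal (2 * y / R)"
    using lap C(1) by (intro quasi_convex_average_bound[OF D y R]) (auto simp: divide_ennreal lap0)
  then have "ennreal (2 * C) * (\<integral>\<^sup>+t\<in>{0<..<1 / R}. \<Phi> t / ennreal (2 * C) \<partial>lborel) \<le>
      ennreal (2 * C) * ennreal (2 * y / R)" by (rule mult_left_mono) simp
  also have "ennreal (2 * C) * ennreal (2 * y / R) = ennreal (4 * C * y / R)"
    using C(1) y R by (simp flip: ennreal_mult)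
  also have "ennreal (2 * C) * (\<integral>\<^sup>+t\<in>{0<..<1 / R}. \<Phi> t / ennreal (2 * C) \<partial>lborel) =
      (\<integral>\<^sup>+t\<in>{0<..<1 / R}. \<Phi> t \<partial>lborel)"
  proof (subst nn_integral_cmult[symmetric])
    have "ennreal (2 * C) * (x / ennreal (2 * C) * k) = x * k" for x k :: ennreal
    proof -
      have "x / ennreal (2 * C) * ennreal (2 * C) = x" using C(1) by (simp add: ennreal_divide_times)
      then show ?thesis by (metis mult.assoc mult.commute)
    qed
    then show "(\<integral>\<^sup>+t. ennreal (2 * C) * (\<Phi> t / ennreal (2 * C) * indicator {0<..<1 / R} t) \<partial>lborel) =
        (\<integral>\<^sup>+t\<in>{0<..<1 / R}. \<Phi> t \<partial>lborel)" by simp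
  qed measurable
  also have "(\<integral>\<^sup>+t\<in>{0<..<1 / R}. \<Phi> t \<partial>lborel) =
      (\<integral>\<^sup>+\<tau>\<in>{0<..}. ennreal (f \<tau>) * ennreal ((1 - exp (- (1 / R * \<tau>))) / \<tau>) \<partial>lborel)"
    unfolding \<Phi>_def using R by (intro nn_integral_laplace_average) auto
  finally have *: "(\<integral>\<^sup>+\<tau>\<in>{0<..}. ennreal (f \<tau>) * ennreal ((1 - exp (- (1 / R * \<tau>))) / \<tau>) \<partial>lborel) \<le> ennreal (4 * C * y / R)" .
  have "(\<integral>\<^sup>+\<tau>\<in>{R<..}. ennreal (f \<tau> / \<tau>) \<partial>lborel) \<le>
      (\<integral>\<^sup>+\<tau>. 2 * (ennreal (f \<tau>) * ennreal ((1 - exp (- (1 / R * \<tau>))) / \<tau>) * indicator {0<..} \<tau>) \<partial>lborel)"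
  proof (intro nn_integral_mono)
    fix \<tau> :: real
    have "ennreal (f \<tau> / \<tau>) \<le> 2 * (ennreal (f \<tau>) * ennreal ((1 - exp (- (1 / R * \<tau>))) / \<tau>))" if "R < \<tau>"
    proof -
      \<comment> \<open>Since \<open>\<tau> / R \<ge> 1\<close>, the factor \<open>1 - exp (- \<tau> / R)\<close> is at least \<open>1 / 2\<close>.\<close>
      have "2 \<le> exp (1::real)" using exp_ge_add_one_self[of 1] by simp
      moreover have "exp 1 \<le> exp (\<tau> / R)" using that R by simp
      ultimately have "2 \<le> exp (\<tau> / R)" by (rule order_trans)
      then have "exp (- (\<tau> / R)) \<le> 1 / 2" by (simp add: exp_minus inverse_eq_divide divide_le_eq)
      then have "f \<tau> * (1 / 2) / \<tau> \<le> f \<tau> * (1 - exp (- (\<tau> / R))) / \<tau>"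
        using that R f0[of \<tau>] by (intro divide_right_mono mult_left_mono) auto
      then have "f \<tau> / \<tau> \<le> 2 * (f \<tau> * ((1 - exp (- (1 / R * \<tau>))) / \<tau>))" by simp
      then have "ennreal (f \<tau> / \<tau>) \<le> ennreal (2 * (f \<tau> * ((1 - exp (- (1 / R * \<tau>))) / \<tau>)))" by (rule ennreal_leI)
      also have "\<dots> = 2 * (ennreal (f \<tau>) * ennreal ((1 - exp (- (1 / R * \<tau>))) / \<tau>))"
        using f0[of \<tau>] by (simp only: ennreal_mult' ennreal_numeral zero_le_numeral)
      finally show ?thesis .
    qed
    then show "ennreal (f \<tau> / \<tau>) * indicator {R<..} \<tau> \<le>
      2 * (ennreal (f \<tau>) * ennreal ((1 - exp (- (1 / R * \<tau>))) / \<tau>) * indicator {0<..} \<tau>)"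
      using R by (auto split: split_indicator)
  qed
  also have "\<dots> = 2 * (\<integral>\<^sup>+\<tau>\<in>{0<..}. ennreal (f \<tau>) * ennreal ((1 - exp (- (1 / R * \<tau>))) / \<tau>) \<partial>lborel)"
    by (rule nn_integral_cmult) measurable
  also have "\<dots> \<le> 2 * ennreal (4 * C * y / R)" by (intro mult_left_mono *) auto
  also have "\<dots> = ennreal (8 * C * y / R)" using C(1) y R by (simp add: numeral_mult_ennreal)
  finally show ?thesis .
qed

text \<open>The classical inequality \<open>A (A* t / t) \<le> A* t\<close>, stated strictly below the critical point \<open>A* t / t\<close> so that it also makes sense where \<open>A* t = \<infinity>\<close>. If it failed at \<open>x\<close>, then \<open>A \<tau> \<ge> \<tau> t\<close> for
all \<open>\<tau> \<ge> x\<close>, so the supremum that defines \<open>A* t\<close> would be at most \<open>x t\<close>.\<close>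
lemma quasi_convex_le_of_less_complementary:
  assumes A: "quasi_convex A" and "0 \<le> x" and less: "ennreal x * t < complementary A t"
  shows "A (ennreal x) \<le> ennreal x * t"
proof (rule ccontr)
  assume *: "\<not> ?thesis"
  then have x: "0 < x" using assms(2) quasi_convex_zero[OF A] by (cases "x = 0") auto
  have "complementary A t \<le> ennreal x * t"
    unfolding complementary_def
  proof (rule SUP_least)
    fix \<tau> :: ennreal assume "\<tau> \<in> {0<..<\<infinity>}"
    then obtain r where r: "\<tau> = ennreal r" "0 < r" by (cases \<tau>) auto
    show "\<tau> * t - A \<tau> \<le> ennreal x * t"
    proof (cases "r \<le> x")
      case True
      have "\<tau> * t - A \<tau> \<le> \<tau> * t" by (rule diff_le_self_ennreal)
      also have "\<dots> \<le> ennreal x * t" using True r by (intro mult_right_mono) (auto intro: ennreal_leI)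
      finally show ?thesis .
    next
      case False
      have "\<tau> * t = ennreal (r / x) * (ennreal x * t)"
        using r x by (simp add: mult.assoc[symmetric] flip: ennreal_mult)
      also have "\<dots> \<le> ennreal (r / x) * A (ennreal x)" using * by (intro mult_left_mono) auto
      also have "\<dots> \<le> A (ennreal (r / x * x))" using False x by (intro quasi_convex_scale A) auto
      finally have "\<tau> * t \<le> A \<tau>" using x r by simp
      moreover have "t \<noteq> \<infinity>" using less x by (auto simp: ennreal_mult_top)
      ultimately show ?thesis using r
        by (simp add: diff_eq_0_ennreal ennreal_mult_less_top less_top)
    qed
  qed
  then show False using less by simp
qed

text \<open>Duality: the preceding estimate for integrals of \<open>f / s\<close>, valid on the unit ball of \<open>L\<^sup>A\<close>, bounds the \<open>A*\<close>-modular of \<open>1 / (\<mu> s)\<close>. Put \<open>\<theta> s = A* (1 / (\<mu> s))\<close>.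
The test function \<open>\<theta> s \<mu> s\<close> has \<open>A\<close>-modular at most the integral of \<open>\<theta>\<close>, while its integral against \<open>1 / s\<close> is \<open>\<mu>\<close> times that integral. Normalising it shows that the integral of
\<open>\<theta>\<close> cannot be large when \<open>\<mu>\<close> is.\<close>
lemma laplace_bounded_tail_estimate:
  assumes A: "quasi_convex A" and D: "quasi_convex D"
    and int: "\<And>f t. f \<in> orlicz_space A \<Longrightarrow> 0 < t \<Longrightarrow> set_integrable lebesgue {0<..} (\<lambda>\<tau>. f \<tau> * exp (- (t * \<tau>)))"
    and C: "0 < C" "\<And>f. f \<in> orlicz_space A \<Longrightarrow> orlicz_norm D (laplace f) \<le> ennreal C * orlicz_norm A f"
    and y: "0 < y" and R: "0 < R" "ennreal R \<le> D (ennreal y)"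
    and \<mu>: "\<mu> = 32 * C * y / R"
  shows "(\<integral>\<^sup>+s\<in>{R<..}. complementary A (ennreal (1 / \<mu> / s)) \<partial>lborel) \<le> 2"
proof -
  have \<mu>0: "0 < \<mu>" using C y R by (simp add: \<mu>)
  define \<theta> where "\<theta> s = complementary A (ennreal (1 / \<mu> / s))" for s
  have [measurable]: "\<theta> \<in> borel_measurable borel" unfolding \<theta>_def by measurable
  have [measurable]: "A \<in> borel_measurable borel" by (rule quasi_convex_measurable[OF A])
  \<comment> \<open>Half of \<open>\<theta>\<close>, cut off in height and range: the factor \<open>1/2\<close> makes the comparison with \<open>\<theta>\<close> strict,
    the truncation makes the integral finite.\<close>
  define g where "g n s = enn2real (min (\<theta> s) (of_nat n)) / 2 * indicator {R<..<R + real n} s" for n s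
  have [measurable]: "g n \<in> borel_measurable borel" for n unfolding g_def by measurable
  have g0: "0 \<le> g n s" for n s by (simp add: g_def)
  have gn: "g n s \<le> real n / 2" for n s
    by (auto simp: g_def indicator_def intro!: enn2real_leI simp flip: ennreal_of_nat_eq_real_of_nat)
  have A_le: "A (ennreal (g n s * (\<mu> * s))) \<le> ennreal (g n s)" for n s
  proof (cases "g n s = 0")
    case False
    then have s: "R < s" by (auto simp: g_def split: split_indicator_asm)
    then have s0: "0 < s" using R by simp
    have eq: "ennreal (g n s * (\<mu> * s)) * ennreal (1 / \<mu> / s) = ennreal (g n s)"
      using \<mu>0 s0 g0[of n s] by (simp flip: ennreal_mult)
    have "ennreal (g n s) < min (\<theta> s) (of_nat n)"
    proof -
      have fin: "min (\<theta> s) (of_nat n) < top" by (simp add: of_nat_less_top min_less_iff_disj)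
      have "g n s = enn2real (min (\<theta> s) (of_nat n)) / 2" using False by (auto simp: g_def split: split_indicator_asm)
      moreover have "0 < g n s" using False g0[of n s] by simp
      ultimately have "ennreal (g n s) < ennreal (enn2real (min (\<theta> s) (of_nat n)))" by (intro ennreal_lessI) auto
      then show ?thesis using fin by simp
    qed
    then have "ennreal (g n s * (\<mu> * s)) * ennreal (1 / \<mu> / s) < complementary A (ennreal (1 / \<mu> / s))"
      unfolding eq by (simp add: \<theta>_def)
    from quasi_convex_le_of_less_complementary[OF A _ this] show ?thesis
      unfolding eq using g0[of n s] \<mu>0 s0 by simp
  qed (simp add: quasi_convex_zero[OF A])
  have bound: "(\<integral>\<^sup>+s. ennreal (g n s) \<partial>lborel) \<le> 1" for n
  proof (rule ccontr)
    assume *: "\<not> ?thesis"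
    have "(\<integral>\<^sup>+s. ennreal (g n s) \<partial>lborel) \<le> (\<integral>\<^sup>+s. ennreal (real n / 2) * indicator {R<..<R + real n} s \<partial>lborel)"
    proof (intro nn_integral_mono)
      fix s
      show "ennreal (g n s) \<le> ennreal (real n / 2) * indicator {R<..<R + real n} s"
        using gn[of n s] by (cases "s \<in> {R<..<R + real n}") (auto intro: ennreal_leI simp: g_def[of n s])
    qed
    also have "\<dots> < \<infinity>" by (subst nn_integral_cmult_indicator) (auto simp: ennreal_mult_less_top)
    finally obtain J where J: "(\<integral>\<^sup>+s. ennreal (g n s) \<partial>lborel) = ennreal J" "0 \<le> J"
      by (cases "\<integral>\<^sup>+s. ennreal (g n s) \<partial>lborel") auto
    with * have J1: "1 < J" by simp
    \<comment> \<open>Division by \<open>J > 1\<close> brings the test function into the unit ball.\<close>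
    define f where "f s = g n s * (\<mu> * s) / J * indicator {0<..} s" for s
    have [measurable]: "f \<in> borel_measurable borel" unfolding f_def by measurable
    have "(\<integral>\<^sup>+s\<in>{0<..}. A (ennreal (f s)) \<partial>lborel) \<le> (\<integral>\<^sup>+s. ennreal (1 / J) * ennreal (g n s) \<partial>lborel)"
    proof (intro nn_integral_mono)
      fix s :: real
      have "A (ennreal (f s)) \<le> ennreal (1 / J) * ennreal (g n s)" if "0 < s"
      proof -
        have "A (ennreal (f s)) = ennreal (1 / J) * (ennreal J * A (ennreal (f s)))"
          using J1 by (simp add: mult.assoc[symmetric] flip: ennreal_mult)
        also have "\<dots> \<le> ennreal (1 / J) * A (ennreal (J * f s))"
          using J1 that g0[of n s] \<mu>0 by (intro mult_left_mono quasi_convex_scale A) (auto simp: f_def)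
        also have "J * f s = g n s * (\<mu> * s)" using J1 that by (simp add: f_def)
        also have "ennreal (1 / J) * A (ennreal (g n s * (\<mu> * s))) \<le> ennreal (1 / J) * ennreal (g n s)"
          by (intro mult_left_mono A_le) auto
        finally show ?thesis .
      qed
      then show "A (ennreal (f s)) * indicator {0<..} s \<le> ennreal (1 / J) * ennreal (g n s)"
        by (auto split: split_indicator)
    qed
    also have "\<dots> = 1" using J J1 by (simp add: nn_integral_cmult flip: ennreal_mult)
    finally have "(\<integral>\<^sup>+s\<in>{R<..}. ennreal (f s / s) \<partial>lborel) \<le> ennreal (8 * C * y / R)"
      using g0[of n] J1 \<mu>0
      by (intro laplace_bounded_dual_estimate[OF D int C y R]) (auto simp: f_def split: split_indicator)
    also have "(\<integral>\<^sup>+s\<in>{R<..}. ennreal (f s / s) \<partial>lborel) = (\<integral>\<^sup>+s. ennreal (\<mu> / J) * ennreal (g n s) \<partial>lborel)"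
      using R(1) J1 \<mu>0 g0[of n]
      by (intro nn_integral_cong) (auto simp: f_def g_def ennreal_mult[symmetric] mult_ac split: split_indicator)
    also have "\<dots> = ennreal \<mu>" using J J1 \<mu>0 by (simp add: nn_integral_cmult flip: ennreal_mult)
    finally have "\<mu> \<le> 8 * C * y / R" using C y R by simp
    moreover have "\<mu> = 4 * (8 * C * y / R)" by (simp add: \<mu>)
    ultimately show False using \<mu>0 by simp
  qed
  have "(\<integral>\<^sup>+s\<in>{R<..}. \<theta> s \<partial>lborel) = (\<integral>\<^sup>+s. (SUP n. 2 * ennreal (g n s)) \<partial>lborel)"
  proof (intro nn_integral_cong antisym)
    fix s :: real
    have g_eq: "2 * ennreal (g n s) = min (\<theta> s) (of_nat n) * indicator {R<..<R + real n} s" for n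
    proof -
      have "min (\<theta> s) (of_nat n) < top" by (simp add: of_nat_less_top min_less_iff_disj)
      then show ?thesis by (auto simp: g_def numeral_mult_ennreal split: split_indicator)
    qed
    show "(SUP n. 2 * ennreal (g n s)) \<le> \<theta> s * indicator {R<..} s"
      unfolding g_eq by (intro SUP_least) (auto split: split_indicator)
    show "\<theta> s * indicator {R<..} s \<le> (SUP n. 2 * ennreal (g n s))"
    proof (rule dense_le)
      fix a assume a: "a < \<theta> s * indicator {R<..} s"
      then have s: "R < s" "a < \<theta> s" by (auto split: split_indicator_asm)
      obtain n1 where "a < of_nat n1" using s ennreal_Ex_less_of_nat[of a] by (meson less_top_ennreal order_less_le_trans top_greatest)
      moreover obtain n2 where "s - R < real n2" using reals_Archimedean2 by blast
      ultimately have n: "a < of_nat (max n1 n2)" "s < R + real (max n1 n2)"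
        by (auto simp: of_nat_max less_max_iff_disj)
      then have "a \<le> 2 * ennreal (g (max n1 n2) s)" unfolding g_eq using s by (simp add: less_imp_le)
      then show "a \<le> (SUP n. 2 * ennreal (g n s))" by (rule SUP_upper2[OF UNIV_I])
    qed
  qed
  also have "\<dots> = (SUP n. \<integral>\<^sup>+s. 2 * ennreal (g n s) \<partial>lborel)"
  proof (rule nn_integral_monotone_convergence_SUP)
    have "g n s \<le> g (Suc n) s" for n s
    proof -
      have "enn2real (min (\<theta> s) (of_nat n)) \<le> enn2real (min (\<theta> s) (of_nat (Suc n)))"
        by (intro enn2real_mono min.mono) (auto simp: of_nat_less_top min_less_iff_disj simp del: of_nat_Suc)
      then show ?thesis by (auto simp: g_def split: split_indicator)
    qed
    then show "incseq (\<lambda>n s. 2 * ennreal (g n s))"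
      by (intro incseq_SucI le_funI mult_left_mono ennreal_leI) auto
  qed measurable
  also have "\<dots> \<le> 2 * 1"
    by (intro SUP_least, subst nn_integral_cmult) (use mult_left_mono[OF bound, of 2] in auto)
  finally show ?thesis by (simp add: \<theta>_def)
qed

text \<open>After inversion of the half-line the tail estimate reads \<open>R * G u \<le> 2\<close> with \<open>u = 1 / (32 C y)\<close>; halving \<open>u\<close> at least halves \<open>G\<close> and replaces the constant \<open>2\<close> by \<open>1\<close>.\<close>
theorem laplace_target_le_B_fun:
  assumes A: "quasi_convex A" and D: "quasi_convex D" and bounded: "laplace_bounded A D"
  obtains C where "0 < C" "\<And>y. 0 < y \<Longrightarrow> D (ennreal y) \<le> B_fun A (ennreal (C * y))"
proof -
  have int: "set_integrable lebesgue {0<..} (\<lambda>\<tau>. f \<tau> * exp (- (t * \<tau>)))"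
    if "f \<in> orlicz_space A" "0 < t" for f t
    using bounded that by (simp add: laplace_bounded_def)
  obtain C where C: "0 < C" "\<And>f. f \<in> orlicz_space A \<Longrightarrow> orlicz_norm D (laplace f) \<le> ennreal C * orlicz_norm A f"
    using bounded by (auto simp: laplace_bounded_def)
  have main: "ennreal R \<le> B_fun A (ennreal (64 * C * y))"
    if y: "0 < y" and R: "0 < R" "ennreal R \<le> D (ennreal y)" for y R
  proof -
    define \<mu> where "\<mu> = 32 * C * y / R"
    have \<mu>0: "0 < \<mu>" using C(1) y R by (simp add: \<mu>_def)
    define u where "u = 1 / (32 * C * y)"
    have u: "0 < u" "1 / \<mu> / R = u" using C(1) y R by (auto simp: u_def \<mu>_def)
    have "ennreal (1 / \<mu>) * G_slope A (ennreal u) \<le> 2"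
      using laplace_bounded_tail_estimate[OF A D int C y R \<mu>_def]
        nn_integral_complementary_tail[of "1 / \<mu>" R A] \<mu>0 R(1) u(2) by simp
    then have "ennreal (1 / R) * (ennreal (1 / \<mu>) * G_slope A (ennreal u)) \<le> ennreal (1 / R) * 2"
      by (rule mult_left_mono) simp
    also have "ennreal (1 / R) * (ennreal (1 / \<mu>) * G_slope A (ennreal u)) = G_fun A (ennreal u)"
      using \<mu>0 R(1) u(2)[symmetric]
      by (simp add: G_fun_eq_slope mult.assoc[symmetric] mult.commute[of R] flip: ennreal_mult)
    finally have "G_fun A (ennreal u) \<le> ennreal (1 / R) * 2" .
    moreover have "ennreal 2 * G_fun A (ennreal (u / 2)) \<le> G_fun A (ennreal u)"
      using G_fun_scale[of 2 "u / 2" A] u by simp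
    ultimately have "2 * G_fun A (ennreal (u / 2)) \<le> 2 * ennreal (1 / R)" by (simp add: mult.commute)
    then have "G_fun A (ennreal (u / 2)) \<le> ennreal (1 / R)"
      by (subst (asm) ennreal_mult_le_mult_iff) auto
    moreover have "u / 2 = 1 / (64 * C * y)" by (simp add: u_def)
    ultimately show ?thesis using C(1) y R(1) by (subst le_B_fun_iff) auto
  qed
  have "D (ennreal y) \<le> B_fun A (ennreal (64 * C * y))" if y: "0 < y" for y
  proof (rule dense_le)
    fix a assume a: "a < D (ennreal y)"
    show "a \<le> B_fun A (ennreal (64 * C * y))"
    proof (cases "a = 0")
      case False
      with a obtain R where "a = ennreal R" "0 < R" by (cases a) auto
      then show ?thesis using main[OF y, of R] a by simp
    qed simp
  qed
  then show ?thesis using that[of "64 * C"] C(1) by simp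
qed

corollary laplace_target_imp_log_condition:
  assumes A: "quasi_convex A" and D: "quasi_convex D" and bounded: "laplace_bounded A D"
  shows "log_condition A"
proof -
  obtain C where C: "0 < C" "\<And>y. 0 < y \<Longrightarrow> D (ennreal y) \<le> B_fun A (ennreal (C * y))"
    using laplace_target_le_B_fun[OF assms] by blast
  obtain y where y: "0 < y" "0 < D (ennreal y)" using quasi_convex_positive_somewhere[OF D] .
  have "0 < B_fun A (ennreal (C * y))" using C(2)[OF y(1)] y(2) by (rule less_le_trans[rotated])
  then have "G_fun A (ennreal (1 / (C * y))) < \<infinity>"
    using C(1) y(1) by (auto simp: B_fun_eq_inverse inverse_ennreal inverse_eq_divide less_top zero_less_iff_neq_zero)
  then show ?thesis using C(1) y(1)
    unfolding log_condition_iff_G_fun_finite[OF A] by (intro exI[of _ "1 / (C * y)"]) auto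
qed

section \<open>Targets built from single values of B\<close>

text \<open>The converse of the tail estimate, for the complete kernel, which is at most \<open>min (1/R) (1/\<tau>)\<close>. The part on \<open>(0,R]\<close> contributes at most \<open>R * A* (1 / (2 y)) \<le> 2 R * G (1/y) \<le> 2\<close>, the
tail at most \<open>R * G (1/y) \<le> 1\<close>.\<close>
lemma complementary_modular_kernel:
  assumes y: "0 < y" and R: "0 < R" and G: "G_fun A (ennreal (1 / y)) \<le> ennreal (1 / R)"
  shows "(\<integral>\<^sup>+\<tau>\<in>{0<..}. complementary A (ennreal ((1 - exp (- (1 / R * \<tau>))) / \<tau> / (2 * y / R))) \<partial>lborel) \<le> 3"
proof -
  define c where "c = R / (2 * y)"
  have c: "0 < c" "c / R = 1 / (2 * y)" using y R by (auto simp: c_def)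
  let ?k = "complementary A (ennreal (1 / (2 * y)))"
  have "(\<integral>\<^sup>+\<tau>\<in>{0<..}. complementary A (ennreal ((1 - exp (- (1 / R * \<tau>))) / \<tau> / (2 * y / R))) \<partial>lborel) \<le>
      (\<integral>\<^sup>+\<tau>. ?k * indicator {0<..R} \<tau> + complementary A (ennreal (c / \<tau>)) * indicator {R<..} \<tau> \<partial>lborel)"
  proof (intro nn_integral_mono)
    fix \<tau> :: real
    have "(1 - exp (- (1 / R * \<tau>))) / \<tau> / (2 * y / R) \<le> 1 / (2 * y)" if "0 < \<tau>"
    proof -
      have "1 - exp (- (1 / R * \<tau>)) \<le> 1 / R * \<tau>"
        using exp_ge_add_one_self[of "- (1 / R * \<tau>)"] by linarith
      then have "(1 - exp (- (1 / R * \<tau>))) / \<tau> \<le> 1 / R" using that by (simp add: divide_le_eq)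
      then have "(1 - exp (- (1 / R * \<tau>))) / \<tau> / (2 * y / R) \<le> 1 / R / (2 * y / R)"
        using y R by (intro divide_right_mono) auto
      also have "1 / R / (2 * y / R) = 1 / (2 * y)" using R by simp
      finally show ?thesis .
    qed
    moreover have "(1 - exp (- (1 / R * \<tau>))) / \<tau> / (2 * y / R) \<le> c / \<tau>" if "0 < \<tau>"
    proof -
      have "(1 - exp (- (1 / R * \<tau>))) / \<tau> / (2 * y / R) = (1 - exp (- (1 / R * \<tau>))) * (c / \<tau>)"
        using y R that by (simp add: c_def)
      also have "\<dots> \<le> 1 * (c / \<tau>)" using that c by (intro mult_right_mono) auto
      finally show ?thesis by simp
    qed
    ultimately show "complementary A (ennreal ((1 - exp (- (1 / R * \<tau>))) / \<tau> / (2 * y / R))) * indicator {0<..} \<tau> \<le>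
        ?k * indicator {0<..R} \<tau> + complementary A (ennreal (c / \<tau>)) * indicator {R<..} \<tau>"
      using R by (auto split: split_indicator intro!: monoD[OF mono_complementary] ennreal_leI)
  qed
  also have "\<dots> = ?k * ennreal R + ennreal c * G_slope A (ennreal (c / R))"
    using c R by (simp add: nn_integral_add nn_integral_cmult_indicator nn_integral_complementary_tail)
  also have "ennreal c * G_slope A (ennreal (c / R)) = ennreal R * G_fun A (ennreal (1 / (2 * y)))"
    using y R c(2) by (simp add: G_fun_eq_slope mult.assoc[symmetric] c_def flip: ennreal_mult)
  also have "\<dots> \<le> ennreal R * ennreal (1 / R)"
    using y by (intro mult_left_mono order_trans[OF G_fun_mono G] ennreal_leI) (auto simp: field_simps)
  also have "?k * ennreal R \<le> 2 * ennreal (1 / R) * ennreal R"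
    using complementary_le_G_fun[of "1 / (2 * y)" A] y mult_left_mono[OF G, of 2]
    by (intro mult_right_mono) auto
  also have "2 * ennreal (1 / R) * ennreal R + ennreal R * ennreal (1 / R) = 3"
  proof -
    have "ennreal (1 / R) * ennreal R = 1" using R by (simp flip: ennreal_mult)
    then show ?thesis by (simp add: mult.assoc mult.commute[of "ennreal R"])
  qed
  finally show ?thesis by (simp add: add_mono)
qed

text \<open>Young's inequality, applied to \<open>\<psi>\<close> and the kernel divided by \<open>\<kappa> = 2 y / R\<close>.\<close>
lemma laplace_average_estimate:
  assumes y: "0 < y" and R: "0 < R" and G: "G_fun A (ennreal (1 / y)) \<le> ennreal (1 / R)"
    and A[measurable]: "A \<in> borel_measurable borel"
    and [measurable]: "\<psi> \<in> borel_measurable borel" and \<psi>0: "\<And>\<tau>. 0 \<le> \<psi> \<tau>"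
    and le1: "(\<integral>\<^sup>+\<tau>\<in>{0<..}. A (ennreal (\<psi> \<tau>)) \<partial>lborel) \<le> 1"
  shows "(\<integral>\<^sup>+t\<in>{0<..<1 / R}. (\<integral>\<^sup>+\<tau>\<in>{0<..}. ennreal (\<psi> \<tau>) * ennreal (exp (- (t * \<tau>))) \<partial>lborel) \<partial>lborel) \<le>
    ennreal (8 * y / R)"
proof -
  define \<kappa> where "\<kappa> = 2 * y / R"
  have \<kappa>: "0 < \<kappa>" using y R by (simp add: \<kappa>_def)
  define w where "w \<tau> = (1 - exp (- (1 / R * \<tau>))) / \<tau>" for \<tau>
  have [measurable]: "w \<in> borel_measurable borel" unfolding w_def by measurable
  have w0: "0 \<le> w \<tau>" if "0 < \<tau>" for \<tau> using that R by (simp add: w_def)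
  have "(\<integral>\<^sup>+t\<in>{0<..<1 / R}. (\<integral>\<^sup>+\<tau>\<in>{0<..}. ennreal (\<psi> \<tau>) * ennreal (exp (- (t * \<tau>))) \<partial>lborel) \<partial>lborel) =
      (\<integral>\<^sup>+\<tau>\<in>{0<..}. ennreal (\<psi> \<tau>) * ennreal (w \<tau>) \<partial>lborel)"
    unfolding w_def using R by (intro nn_integral_laplace_average) auto
  also have "\<dots> \<le> (\<integral>\<^sup>+\<tau>. ennreal \<kappa> * (A (ennreal (\<psi> \<tau>)) * indicator {0<..} \<tau> +
      complementary A (ennreal (w \<tau> / \<kappa>)) * indicator {0<..} \<tau>) \<partial>lborel)"
  proof (intro nn_integral_mono)
    fix \<tau> :: real
    have "ennreal (\<psi> \<tau>) * ennreal (w \<tau>) \<le> ennreal \<kappa> * (A (ennreal (\<psi> \<tau>)) + complementary A (ennreal (w \<tau> / \<kappa>)))" if "0 < \<tau>"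
    proof -
      have "ennreal (\<psi> \<tau>) * ennreal (w \<tau>) = ennreal \<kappa> * (ennreal (\<psi> \<tau>) * ennreal (w \<tau> / \<kappa>))"
        using w0[OF that] \<psi>0[of \<tau>] \<kappa> by (simp flip: ennreal_mult)
      also have "\<dots> \<le> ennreal \<kappa> * (A (ennreal (\<psi> \<tau>)) + complementary A (ennreal (w \<tau> / \<kappa>)))"
        by (intro mult_left_mono young_inequality \<psi>0) auto
      finally show ?thesis .
    qed
    then show "ennreal (\<psi> \<tau>) * ennreal (w \<tau>) * indicator {0<..} \<tau> \<le>
        ennreal \<kappa> * (A (ennreal (\<psi> \<tau>)) * indicator {0<..} \<tau> + complementary A (ennreal (w \<tau> / \<kappa>)) * indicator {0<..} \<tau>)"
      by (auto split: split_indicator)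
  qed
  also have "\<dots> = ennreal \<kappa> * ((\<integral>\<^sup>+\<tau>\<in>{0<..}. A (ennreal (\<psi> \<tau>)) \<partial>lborel) +
      (\<integral>\<^sup>+\<tau>\<in>{0<..}. complementary A (ennreal (w \<tau> / \<kappa>)) \<partial>lborel))"
    by (simp add: nn_integral_cmult nn_integral_add)
  also have "\<dots> \<le> ennreal \<kappa> * (1 + 3)"
    using complementary_modular_kernel[OF y R G]
    by (intro mult_left_mono add_mono le1) (auto simp: w_def \<kappa>_def)
  also have "\<dots> = ennreal (8 * y / R)"
  proof -
    have "(1 + 3 :: ennreal) = ennreal 4" by simp
    then show ?thesis using y R by (simp only: \<kappa>_def ennreal_mult'[symmetric] zero_le_numeral ennreal_mult''[symmetric])
        (simp add: mult.commute)
  qed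
  finally show ?thesis .
qed

text \<open>Before weighting, the \<open>k\<close>-th summand is cut off at \<open>y k\<close> and takes values close to \<open>R k\<close> just to the right of it. It is linear beyond \<open>y k\<close>, the slowest
growth that quasi-convexity permits. The vanishing at \<open>y k\<close> itself makes it left-continuous.\<close>
definition threshold_sum :: "(nat \<Rightarrow> real) \<Rightarrow> (nat \<Rightarrow> real) \<Rightarrow> ennreal \<Rightarrow> ennreal" where
  "threshold_sum y R x =
    (\<Sum>k. ennreal ((1 / 2) ^ Suc k) * (if x \<le> ennreal (y k) then 0 else ennreal (R k / y k) * x))"

lemma suminf_half_powers: "(\<Sum>k. ennreal ((1 / 2) ^ Suc k)) = 1"
proof -
  have "(\<Sum>k. ennreal ((1 / 2) ^ Suc k)) = ennreal 1"
    by (rule suminf_ennreal_eq[OF _ power_half_series]) simp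
  then show ?thesis by simp
qed

lemma threshold_sum_le_B_fun:
  assumes "\<And>k. 0 < y k" "\<And>k. 0 < R k" "\<And>k. ennreal (R k) \<le> B_fun A (ennreal (y k))" "0 < x"
  shows "threshold_sum y R (ennreal x) \<le> B_fun A (ennreal x)"
proof -
  have "(if ennreal x \<le> ennreal (y k) then 0 else ennreal (R k / y k) * ennreal x) \<le> B_fun A (ennreal x)" for k
  proof (cases "x \<le> y k")
    case False
    have "ennreal (R k / y k) * ennreal x = ennreal (x / y k) * ennreal (R k)"
      using assms(1,2)[of k] \<open>0 < x\<close> by (simp flip: ennreal_mult)
    also have "\<dots> \<le> ennreal (x / y k) * B_fun A (ennreal (y k))" by (intro mult_left_mono assms) auto
    also have "\<dots> \<le> B_fun A (ennreal (x / y k * y k))"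
      using False assms(1)[of k] by (intro B_fun_scale) auto
    finally show ?thesis using assms(1)[of k] by simp
  qed (simp add: ennreal_leI)
  then have "threshold_sum y R (ennreal x) \<le> (\<Sum>k. ennreal ((1 / 2) ^ Suc k) * B_fun A (ennreal x))"
    unfolding threshold_sum_def by (intro suminf_le mult_left_mono) auto
  also have "\<dots> = B_fun A (ennreal x)" by (simp only: ennreal_suminf_multc suminf_half_powers mult_1)
  finally show ?thesis .
qed

text \<open>Moving from \<open>y k\<close> to \<open>2 ^ (k + 1) * y k\<close> compensates for the weight.\<close>
lemma threshold_sum_lower:
  assumes "0 < y k" "0 < R k"
  shows "ennreal (R k) \<le> threshold_sum y R (ennreal (2 ^ Suc k * y k))"
proof -
  have "y k < 2 ^ Suc k * y k" using assms one_less_power[of "2::real" "Suc k"] by simp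
  then have "\<not> ennreal (2 ^ Suc k * y k) \<le> ennreal (y k)" using assms by (simp add: not_le ennreal_less_iff)
  then have "ennreal (R k) = ennreal ((1 / 2) ^ Suc k) *
      (if ennreal (2 ^ Suc k * y k) \<le> ennreal (y k) then 0 else ennreal (R k / y k) * ennreal (2 ^ Suc k * y k))"
    using assms by (simp add: power_one_over flip: ennreal_mult)
  also have "\<dots> \<le> threshold_sum y R (ennreal (2 ^ Suc k * y k))"
    unfolding threshold_sum_def
    using sum_le_suminf[of "\<lambda>j. ennreal ((1 / 2) ^ Suc j) * (if ennreal (2 ^ Suc k * y k) \<le> ennreal (y j) then 0
      else ennreal (R j / y j) * ennreal (2 ^ Suc k * y k))" "{k}"] by simp
  finally show ?thesis .
qed

lemma quasi_convex_threshold_sum: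
  assumes y: "\<And>k. 0 < y k" and R: "\<And>k. 0 < R k"
    and fin: "0 < x\<^sub>1" "threshold_sum y R (ennreal x\<^sub>1) \<noteq> \<infinity>"
  shows "quasi_convex (threshold_sum y R)"
proof (rule quasi_convexI)
  show "mono (threshold_sum y R)"
  proof (rule monoI)
    fix s t :: ennreal assume "s \<le> t"
    then have "(if s \<le> ennreal (y k) then 0 else ennreal (R k / y k) * s) \<le>
        (if t \<le> ennreal (y k) then 0 else ennreal (R k / y k) * t)" for k
      using order_trans[of s t] by (auto intro: mult_left_mono)
    then have "ennreal ((1 / 2) ^ Suc k) * (if s \<le> ennreal (y k) then 0 else ennreal (R k / y k) * s) \<le>
        ennreal ((1 / 2) ^ Suc k) * (if t \<le> ennreal (y k) then 0 else ennreal (R k / y k) * t)" for k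
      by (rule mult_left_mono) simp
    then show "threshold_sum y R s \<le> threshold_sum y R t"
      unfolding threshold_sum_def by (rule suminf_le) (rule summableI)+
  qed
  show "threshold_sum y R 0 = 0" by (simp add: threshold_sum_def)
  show "\<exists>t>0. threshold_sum y R t \<noteq> \<infinity>" using fin by (intro exI[of _ "ennreal x\<^sub>1"]) auto
  show "\<exists>t. threshold_sum y R t \<noteq> 0"
  proof
    have "ennreal (R 0) \<le> threshold_sum y R (ennreal (2 ^ Suc 0 * y 0))"
      by (rule threshold_sum_lower) (rule y R)+
    then have "0 < threshold_sum y R (ennreal (2 ^ Suc 0 * y 0))"
      by (rule less_le_trans[rotated]) (simp add: R)
    then show "threshold_sum y R (ennreal (2 ^ Suc 0 * y 0)) \<noteq> 0" by (rule less_imp_neq[symmetric])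
  qed
  show "ennreal c * threshold_sum y R (ennreal x) \<le> threshold_sum y R (ennreal (c * x))" if cx: "1 \<le> c" "0 < x" for c x
    unfolding threshold_sum_def ennreal_suminf_cmult[symmetric]
  proof (rule suminf_le[OF _ summableI summableI])
    fix k
    have "x \<le> c * x" using cx by simp
    then have le: "ennreal x \<le> ennreal (c * x)" by (rule ennreal_leI)
    have "ennreal c * (if ennreal x \<le> ennreal (y k) then 0 else ennreal (R k / y k) * ennreal x) \<le>
        (if ennreal (c * x) \<le> ennreal (y k) then 0 else ennreal (R k / y k) * ennreal (c * x))"
    proof (cases "ennreal x \<le> ennreal (y k)")
      case False
      then have "\<not> ennreal (c * x) \<le> ennreal (y k)" using le by (meson order_trans)
      then show ?thesis using False cx by (simp add: ennreal_mult mult.left_commute)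
    qed simp
    then show "ennreal c * (ennreal ((1 / 2) ^ Suc k) * (if ennreal x \<le> ennreal (y k) then 0 else ennreal (R k / y k) * ennreal x)) \<le>
        ennreal ((1 / 2) ^ Suc k) * (if ennreal (c * x) \<le> ennreal (y k) then 0 else ennreal (R k / y k) * ennreal (c * x))"
      unfolding mult.left_commute[of "ennreal c"] by (rule mult_left_mono) simp
  qed
  fix t :: ennreal assume t: "t > 0"
  define E where "E k x = ennreal ((1 / 2) ^ Suc k) * (if x \<le> ennreal (y k) then 0 else ennreal (R k / y k) * x)" for k x
  have lim: "(E k \<longlongrightarrow> E k t) (at_left t)" for k
  proof (cases "t \<le> ennreal (y k)")
    case True
    have "\<forall>\<^sub>F x in at_left t. E k x = E k t"
      using t True by (subst eventually_at_left[of 0]) (auto simp: E_def intro!: exI[of _ 0])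
    then show ?thesis by (rule tendsto_eventually)
  next
    case False
    have ev: "\<forall>\<^sub>F x in at_left t. ennreal ((1 / 2) ^ Suc k) * (ennreal (R k / y k) * x) = E k x"
      using t False by (subst eventually_at_left[of 0]) (auto simp: E_def not_le intro!: exI[of _ "ennreal (y k)"])
    have "((\<lambda>x. ennreal ((1 / 2) ^ Suc k) * (ennreal (R k / y k) * x)) \<longlongrightarrow>
        ennreal ((1 / 2) ^ Suc k) * (ennreal (R k / y k) * t)) (at_left t)"
      by (intro ennreal_tendsto_cmult tendsto_ident_at) auto
    moreover have "ennreal ((1 / 2) ^ Suc k) * (ennreal (R k / y k) * t) = E k t"
      using False by (simp only: E_def if_False)
    ultimately show ?thesis using Lim_transform_eventually[OF _ ev] by (simp only:)
  qed
  show "threshold_sum y R t \<le> (SUP s\<in>{..<t}. threshold_sum y R s)"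
  proof (rule dense_le)
    fix a assume "a < threshold_sum y R t"
    then have "a < (SUP n. \<Sum>k<n. E k t)"
      unfolding threshold_sum_def E_def[symmetric] suminf_eq_SUP .
    then obtain n where "a < (\<Sum>k<n. E k t)" by (auto simp: less_SUP_iff)
    moreover have "((\<lambda>x. \<Sum>k<n. E k x) \<longlongrightarrow> (\<Sum>k<n. E k t)) (at_left t)" by (intro tendsto_sum lim)
    ultimately have "\<forall>\<^sub>F x in at_left t. a < (\<Sum>k<n. E k x)" by (rule order_tendstoD(1)[rotated])
    then obtain b where "b < t" "\<forall>x>b. x < t \<longrightarrow> a < (\<Sum>k<n. E k x)"
      using t by (subst (asm) eventually_at_left[of 0]) auto
    then obtain s where s: "s < t" "a < (\<Sum>k<n. E k s)" using dense by blast
    have "(\<Sum>k<n. E k s) \<le> threshold_sum y R s"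
      unfolding threshold_sum_def E_def[symmetric] by (intro sum_le_suminf) auto
    then show "a \<le> (SUP s\<in>{..<t}. threshold_sum y R s)" using s by (intro SUP_upper2[of s]) auto
  qed
qed

text \<open>Let \<open>\<Phi>\<close> be the transform of \<open>\<bar>f\<bar> / l\<close>, which is decreasing and has integral at most \<open>8 y\<^sub>k / R\<^sub>k\<close> over \<open>(0, 1/R\<^sub>k)\<close>. Then \<open>\<Phi> / 8\<close> can exceed \<open>y\<^sub>k\<close> only in this interval, so the
modular of the \<open>k\<close>-th summand is at most \<open>1\<close> before weighting, for every \<open>k\<close> with the same constant \<open>8\<close>.\<close>
lemma laplace_threshold_sum_estimate:
  assumes A: "quasi_convex A"
    and y: "\<And>k. 0 < y k" and R: "\<And>k. 0 < R k"
    and G: "\<And>k. G_fun A (ennreal (1 / y k)) \<le> ennreal (1 / R k)"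
    and f: "f \<in> orlicz_space A"
    and int: "\<And>t. 0 < t \<Longrightarrow> set_integrable lebesgue {0<..} (\<lambda>\<tau>. f \<tau> * exp (- (t * \<tau>)))"
  shows "orlicz_norm (threshold_sum y R) (laplace f) \<le> ennreal 8 * orlicz_norm A f"
proof (rule le_orlicz_normI, simp)
  fix l :: real
  assume l: "0 < l" "(\<integral>\<^sup>+x. A (ennreal (\<bar>f x\<bar> / l)) \<partial>lebesgue_on {0<..}) \<le> 1"
  have "f \<in> borel_measurable (lebesgue_on {0<..})" using f by (simp add: orlicz_space_def)
  \<comment> \<open>A Borel representative \<open>g\<close> of \<open>f\<close> makes Fubini's theorem for \<^const>\<open>lborel\<close> applicable.\<close>
  then have "(\<lambda>x. indicator {0<..} x *\<^sub>R f x) \<in> borel_measurable lebesgue"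
    by (subst (asm) borel_measurable_restrict_space_iff) auto
  then obtain g where g[measurable]: "g \<in> borel_measurable lborel"
    and fg: "AE x in lborel. indicator {0<..} x *\<^sub>R f x = g x"
    using completion_ex_borel_measurable_real by blast
  define \<psi> where "\<psi> \<tau> = \<bar>g \<tau>\<bar> / l" for \<tau>
  have [measurable]: "\<psi> \<in> borel_measurable borel" unfolding \<psi>_def using g by measurable
  have \<psi>0: "0 \<le> \<psi> \<tau>" for \<tau> using l by (simp add: \<psi>_def)
  have "(\<integral>\<^sup>+\<tau>\<in>{0<..}. A (ennreal (\<psi> \<tau>)) \<partial>lborel) = (\<integral>\<^sup>+\<tau>\<in>{0<..}. A (ennreal (\<bar>f \<tau>\<bar> / l)) \<partial>lborel)"
    by (intro nn_integral_cong_AE eventually_mono[OF fg]) (auto simp: \<psi>_def split: split_indicator)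
  then have \<psi>1: "(\<integral>\<^sup>+\<tau>\<in>{0<..}. A (ennreal (\<psi> \<tau>)) \<partial>lborel) \<le> 1"
    using l(2) by (simp add: nn_integral_lebesgue_on_positive)
  define \<Phi> where "\<Phi> t = (\<integral>\<^sup>+\<tau>\<in>{0<..}. ennreal (\<psi> \<tau>) * ennreal (exp (- (t * \<tau>))) \<partial>lborel)" for t
  have [measurable]: "\<Phi> \<in> borel_measurable borel" unfolding \<Phi>_def by measurable
  have avg: "(\<integral>\<^sup>+t\<in>{0<..<1 / R k}. \<Phi> t \<partial>lborel) \<le> ennreal (8 * y k / R k)" for k
    unfolding \<Phi>_def
    by (rule laplace_average_estimate[OF y R G quasi_convex_measurable[OF A] _ \<psi>0 \<psi>1]) measurable
  have anti: "\<Phi> t \<le> \<Phi> s" if "s \<le> t" for s t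
    unfolding \<Phi>_def using that
    by (intro nn_integral_mono) (auto intro!: mult_left_mono ennreal_leI split: split_indicator)
  have lap: "ennreal (\<bar>laplace f t\<bar> / l) \<le> \<Phi> t" if "0 < t" for t
  proof -
    have "ennreal (norm (laplace f t)) \<le>
        (\<integral>\<^sup>+\<tau>. ennreal (norm (indicator {0<..} \<tau> *\<^sub>R (f \<tau> * exp (- (t * \<tau>))))) \<partial>lebesgue)"
      unfolding laplace_def set_lebesgue_integral_def
      using int[OF that] by (intro integral_norm_bound_ennreal) (simp add: set_integrable_def)
    also have "\<dots> = (\<integral>\<^sup>+\<tau>. ennreal l * (ennreal (\<psi> \<tau>) * ennreal (exp (- (t * \<tau>))) * indicator {0<..} \<tau>) \<partial>lborel)"
      unfolding nn_integral_completion using l(1)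
      by (intro nn_integral_cong_AE eventually_mono[OF fg])
        (auto simp: \<psi>_def abs_mult split: split_indicator simp flip: ennreal_mult)
    also have "\<dots> = ennreal l * \<Phi> t"
      unfolding \<Phi>_def by (rule nn_integral_cmult) measurable
    finally have "ennreal (1 / l) * ennreal \<bar>laplace f t\<bar> \<le> ennreal (1 / l) * (ennreal l * \<Phi> t)"
      by (intro mult_left_mono) auto
    then show ?thesis using l(1) by (simp add: mult.assoc[symmetric] flip: ennreal_mult)
  qed
  have step: "(if ennreal (\<bar>laplace f t\<bar> / (8 * l)) \<le> ennreal (y k) then 0
        else ennreal (R k / y k) * ennreal (\<bar>laplace f t\<bar> / (8 * l))) \<le>
      ennreal (R k / (8 * y k)) * (\<Phi> t * indicator {0<..<1 / R k} t)" if t: "0 < t" for t k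
  proof (cases "\<bar>laplace f t\<bar> / (8 * l) \<le> y k")
    case False
    have "t < 1 / R k"
    proof (rule ccontr)
      assume *: "\<not> t < 1 / R k"
      have "ennreal (\<bar>laplace f t\<bar> / l) * ennreal (1 / R k) \<le> \<Phi> t * ennreal (1 / R k)"
        by (intro mult_right_mono lap t) auto
      also have "\<dots> = (\<integral>\<^sup>+s. \<Phi> t * indicator {0<..<1 / R k} s \<partial>lborel)"
        using R[of k] by (subst nn_integral_cmult_indicator) auto
      also have "\<dots> \<le> (\<integral>\<^sup>+s\<in>{0<..<1 / R k}. \<Phi> s \<partial>lborel)"
        using * by (intro nn_integral_mono) (auto split: split_indicator intro!: anti)
      also have "\<dots> \<le> ennreal (8 * y k / R k)" by (rule avg)
      finally have "\<bar>laplace f t\<bar> / l * (1 / R k) \<le> 8 * y k / R k"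
        using R[of k] y[of k] l(1) by (simp flip: ennreal_mult)
      then have "\<bar>laplace f t\<bar> / l * (1 / R k) \<le> 8 * y k * (1 / R k)" by simp
      then have "\<bar>laplace f t\<bar> / l \<le> 8 * y k" by (rule mult_right_le_imp_le) (simp add: R)
      then show False using False by simp
    qed
    have "ennreal (R k / y k) * ennreal (\<bar>laplace f t\<bar> / (8 * l)) = ennreal (R k / (8 * y k)) * ennreal (\<bar>laplace f t\<bar> / l)"
      using R[of k] y[of k] l(1) by (simp add: mult_ac flip: ennreal_mult)
    also have "\<dots> \<le> ennreal (R k / (8 * y k)) * \<Phi> t" by (intro mult_left_mono lap t) auto
    finally show ?thesis using \<open>t < 1 / R k\<close> t by simp
  qed (simp add: ennreal_leI)
  have "(\<integral>\<^sup>+t. threshold_sum y R (ennreal (\<bar>laplace f t\<bar> / (8 * l))) \<partial>lebesgue_on {0<..}) \<le>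
      (\<integral>\<^sup>+t. (\<Sum>k. ennreal ((1 / 2) ^ Suc k) * (ennreal (R k / (8 * y k)) * (\<Phi> t * indicator {0<..<1 / R k} t))) \<partial>lborel)"
    unfolding nn_integral_lebesgue_on_positive
  proof (intro nn_integral_mono)
    fix t :: real
    have "threshold_sum y R (ennreal (\<bar>laplace f t\<bar> / (8 * l))) \<le>
        (\<Sum>k. ennreal ((1 / 2) ^ Suc k) * (ennreal (R k / (8 * y k)) * (\<Phi> t * indicator {0<..<1 / R k} t)))" if "0 < t"
      unfolding threshold_sum_def
      by (rule suminf_le[OF _ summableI summableI], rule mult_left_mono[OF step[OF that]]) simp
    then show "threshold_sum y R (ennreal (\<bar>laplace f t\<bar> / (8 * l))) * indicator {0<..} t \<le>
        (\<Sum>k. ennreal ((1 / 2) ^ Suc k) * (ennreal (R k / (8 * y k)) * (\<Phi> t * indicator {0<..<1 / R k} t)))"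
      by (cases "0 < t") auto
  qed
  also have "\<dots> = (\<Sum>k. ennreal ((1 / 2) ^ Suc k) * (ennreal (R k / (8 * y k)) * (\<integral>\<^sup>+t\<in>{0<..<1 / R k}. \<Phi> t \<partial>lborel)))"
  proof (subst nn_integral_suminf)
    have "(\<integral>\<^sup>+t. ennreal ((1 / 2) ^ Suc k) * (ennreal (R k / (8 * y k)) * (\<Phi> t * indicator {0<..<1 / R k} t)) \<partial>lborel) =
        ennreal ((1 / 2) ^ Suc k) * (ennreal (R k / (8 * y k)) * (\<integral>\<^sup>+t\<in>{0<..<1 / R k}. \<Phi> t \<partial>lborel))" for k
      by (subst nn_integral_cmult, measurable, subst nn_integral_cmult, measurable)
    then show "(\<Sum>k. \<integral>\<^sup>+t. ennreal ((1 / 2) ^ Suc k) * (ennreal (R k / (8 * y k)) * (\<Phi> t * indicator {0<..<1 / R k} t)) \<partial>lborel) =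
        (\<Sum>k. ennreal ((1 / 2) ^ Suc k) * (ennreal (R k / (8 * y k)) * (\<integral>\<^sup>+t\<in>{0<..<1 / R k}. \<Phi> t \<partial>lborel)))"
      by (simp only:)
  qed measurable
  also have "\<dots> \<le> (\<Sum>k. ennreal ((1 / 2) ^ Suc k))"
  proof (rule suminf_le[OF _ summableI summableI])
    fix k
    have "ennreal (R k / (8 * y k)) * (\<integral>\<^sup>+t\<in>{0<..<1 / R k}. \<Phi> t \<partial>lborel) \<le>
        ennreal (R k / (8 * y k)) * ennreal (8 * y k / R k)" by (intro mult_left_mono avg) auto
    also have "\<dots> = 1" using R[of k] y[of k] by (simp flip: ennreal_mult)
    finally have "ennreal ((1 / 2) ^ Suc k) * (ennreal (R k / (8 * y k)) * (\<integral>\<^sup>+t\<in>{0<..<1 / R k}. \<Phi> t \<partial>lborel)) \<le>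
        ennreal ((1 / 2) ^ Suc k) * 1" by (rule mult_left_mono) simp
    then show "ennreal ((1 / 2) ^ Suc k) * (ennreal (R k / (8 * y k)) * (\<integral>\<^sup>+t\<in>{0<..<1 / R k}. \<Phi> t \<partial>lborel)) \<le>
        ennreal ((1 / 2) ^ Suc k)" by (simp only: mult_1_right)
  qed
  also note suminf_half_powers
  finally show "orlicz_norm (threshold_sum y R) (laplace f) \<le> ennreal (8 * l)"
    using l(1) by (intro orlicz_norm_le) auto
qed

section \<open>Inclusions between Orlicz spaces\<close>

text \<open>If no dilation works, there are points \<open>x k\<close> with \<open>D (4 ^ (k + 2) * x k) < E (x k)\<close>. A step function with the values \<open>v k = 2 ^ (k + 2) * x k\<close> on intervals of length \<open>m k\<close> then separates the spaces:
half of the factor \<open>4 ^ (k + 2)\<close> (on the logarithmic scale) makes the \<open>D\<close>-modular summable, the other half beats every fixed \<open>l\<close> in the \<open>E\<close>-modular.\<close>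
lemma orlicz_space_subset_imp_dilate:
  assumes D: "quasi_convex D" and E: "mono E" and sub: "orlicz_space D \<subseteq> orlicz_space E"
  obtains K where "0 < K" "\<And>x. 0 < x \<Longrightarrow> E (ennreal x) \<le> D (ennreal (K * x))"
proof (rule ccontr)
  assume no: "\<not> thesis"
  have "\<exists>x>0. D (ennreal (4 ^ (k + 2) * x)) < E (ennreal x)" for k :: nat
  proof (rule ccontr)
    assume "\<not> ?thesis"
    then have "\<And>x. 0 < x \<Longrightarrow> E (ennreal x) \<le> D (ennreal (4 ^ (k + 2) * x))" by (meson not_less)
    then show False using no that[of "4 ^ (k + 2)"] by simp
  qed
  then obtain x where x: "\<And>k. 0 < x k" "\<And>k. D (ennreal (4 ^ (k + 2) * x k)) < E (ennreal (x k))" by metis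
  \<comment> \<open>The lengths put the two modulars on either side of \<open>2\<close>, so that a single interval already gives an
    \<open>E\<close>-modular above \<open>1\<close>.\<close>
  have "\<exists>m>0. ennreal m * D (ennreal (4 ^ (k + 2) * x k)) \<le> 2 \<and> 2 \<le> ennreal m * E (ennreal (x k))" for k
  proof -
    obtain b where b: "D (ennreal (4 ^ (k + 2) * x k)) < b" "b < E (ennreal (x k))" using dense[OF x(2)] by blast
    have "0 < b" using b(1) by (rule le_less_trans[OF zero_le])
    then obtain r where r: "b = ennreal r" "0 < r" using b(2) by (cases b) auto
    have "ennreal (2 / r) * D (ennreal (4 ^ (k + 2) * x k)) \<le> ennreal (2 / r) * ennreal r"
      using b r by (intro mult_left_mono) auto
    moreover have "ennreal (2 / r) * ennreal r \<le> ennreal (2 / r) * E (ennreal (x k))"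
      using b r by (intro mult_left_mono) auto
    moreover have "ennreal (2 / r) * ennreal r = 2" using r by (simp flip: ennreal_mult)
    ultimately show ?thesis using r by (intro exI[of _ "2 / r"]) auto
  qed
  then obtain m where m: "\<And>k. 0 < m k" "\<And>k. ennreal (m k) * D (ennreal (4 ^ (k + 2) * x k)) \<le> 2"
      "\<And>k. 2 \<le> ennreal (m k) * E (ennreal (x k))" by metis
  define v where "v k = 2 ^ (k + 2) * x k" for k
  have v0: "0 \<le> v k" for k using x(1)[of k] by (simp add: v_def)
  have Dv: "D (ennreal (v k)) * ennreal (m k) \<le> ennreal ((1 / 2) ^ Suc k)" for k
  proof -
    have "ennreal (2 ^ (k + 2)) * D (ennreal (v k)) \<le> D (ennreal (2 ^ (k + 2) * v k))"
      by (intro quasi_convex_scale D v0 one_le_power) simp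
    also have "2 ^ (k + 2) * v k = 4 ^ (k + 2) * x k"
      unfolding v_def by (simp only: mult.assoc[symmetric] power_mult_distrib[symmetric]) simp
    finally have "ennreal (m k) * (ennreal (2 ^ (k + 2)) * D (ennreal (v k))) \<le> ennreal (m k) * D (ennreal (4 ^ (k + 2) * x k))"
      by (rule mult_left_mono) simp
    also have "\<dots> \<le> 2" by (rule m)
    finally have "ennreal ((1 / 2) ^ (k + 2)) * (ennreal (m k) * (ennreal (2 ^ (k + 2)) * D (ennreal (v k)))) \<le>
        ennreal ((1 / 2) ^ (k + 2)) * ennreal 2" by (intro mult_left_mono) auto
    also have "ennreal ((1 / 2) ^ (k + 2)) * ennreal 2 = ennreal ((1 / 2) ^ Suc k)"
      by (simp only: ennreal_mult'[symmetric] zero_le_power zero_le_divide_1_iff zero_le_numeral) simp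
    also have "ennreal ((1 / 2) ^ (k + 2)) * (ennreal (m k) * (ennreal (2 ^ (k + 2)) * D (ennreal (v k)))) =
        ennreal ((1 / 2) ^ (k + 2)) * ennreal (2 ^ (k + 2)) * (D (ennreal (v k)) * ennreal (m k))"
      by (simp only: mult_ac)
    also have "ennreal ((1 / 2) ^ (k + 2)) * ennreal (2 ^ (k + 2)) = 1"
    proof -
      have "((1 / 2) ^ (k + 2) * 2 ^ (k + 2) :: real) = 1" by (simp only: power_mult_distrib[symmetric]) simp
      then show ?thesis by (simp only: ennreal_mult'[symmetric] zero_le_power zero_le_divide_1_iff zero_le_numeral ennreal_1)
    qed
    finally show ?thesis by simp
  qed
  define s where "s k = (\<Sum>j<k. m j)" for k
  define I where "I k = {s k<..s (Suc k)}" for k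
  have s0: "0 \<le> s k" for k unfolding s_def using m(1) by (intro sum_nonneg) (auto intro: less_imp_le)
  have "mono s" unfolding s_def using m(1) by (intro monoI sum_mono2) (auto intro: less_imp_le)
  have I_meas: "emeasure lborel (I k) = ennreal (m k)" for k
    using m(1)[of k] by (simp add: I_def s_def)
  have disj: "i = j" if "t \<in> I i" "t \<in> I j" for t i j
  proof (rule ccontr)
    assume "i \<noteq> j"
    then consider "Suc i \<le> j" | "Suc j \<le> i" by linarith
    then show False
    proof cases
      case 1
      with \<open>mono s\<close> have "s (Suc i) \<le> s j" by (rule monoD)
      then show False using that by (auto simp: I_def)
    next
      case 2
      with \<open>mono s\<close> have "s (Suc j) \<le> s i" by (rule monoD)
      then show False using that by (auto simp: I_def)
    qed
  qed
  define f where "f t = (\<Sum>k. v k * indicator (I k) t)" for t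
  have f_eq: "f t = v k" if "t \<in> I k" for t k
  proof -
    have "f t = (\<Sum>j\<in>{k}. v j * indicator (I j) t)"
      unfolding f_def using disj[OF that] by (intro suminf_finite) (auto split: split_indicator)
    then show ?thesis using that by simp
  qed
  have f_zero: "f t = 0" if "\<And>k. t \<notin> I k" for t using that by (simp add: f_def)
  have f_meas[measurable]: "f \<in> borel_measurable borel"
    unfolding f_def I_def by measurable
  have [measurable]: "D \<in> borel_measurable borel" by (rule quasi_convex_measurable[OF D])
  have I_sets[measurable]: "I k \<in> sets borel" for k by (simp add: I_def)
  have "(\<integral>\<^sup>+t. D (ennreal (\<bar>f t\<bar> / 1)) \<partial>lebesgue_on {0<..}) \<le>
      (\<integral>\<^sup>+t. (\<Sum>k. D (ennreal (v k)) * indicator (I k) t) \<partial>lborel)"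
    unfolding nn_integral_lebesgue_on_positive
  proof (intro nn_integral_mono)
    fix t :: real
    have "D (ennreal \<bar>f t\<bar>) \<le> (\<Sum>k. D (ennreal (v k)) * indicator (I k) t)"
    proof (cases "\<exists>k. t \<in> I k")
      case True
      then obtain k where k: "t \<in> I k" ..
      then have "D (ennreal \<bar>f t\<bar>) = (\<Sum>j\<in>{k}. D (ennreal (v j)) * indicator (I j) t)"
        using v0[of k] by (simp add: f_eq)
      also have "\<dots> \<le> (\<Sum>j. D (ennreal (v j)) * indicator (I j) t)" by (intro sum_le_suminf) auto
      finally show ?thesis .
    next
      case False
      then show ?thesis by (simp add: f_zero quasi_convex_zero[OF D])
    qed
    then show "D (ennreal (\<bar>f t\<bar> / 1)) * indicator {0<..} t \<le> (\<Sum>k. D (ennreal (v k)) * indicator (I k) t)"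
      by (auto split: split_indicator)
  qed
  also have "\<dots> = (\<Sum>k. D (ennreal (v k)) * ennreal (m k))"
    by (subst nn_integral_suminf) (auto simp: nn_integral_cmult_indicator I_meas)
  also have "\<dots> \<le> (\<Sum>k. ennreal ((1 / 2) ^ Suc k))" by (rule suminf_le[OF Dv summableI summableI])
  also note suminf_half_powers
  finally have "orlicz_norm D f \<le> ennreal 1" by (intro orlicz_norm_le) auto
  then have "f \<in> orlicz_space D"
    unfolding orlicz_space_def by (auto intro!: measurable_restrict_space1 measurable_completion intro: le_less_trans)
  then have "f \<in> orlicz_space E" using sub by blast
  then have "orlicz_norm E f < \<infinity>" by (simp add: orlicz_space_def)
  then obtain l where l: "orlicz_norm E f < ennreal l" "0 < l"
    by (metis dense ennreal_cases infinity_ennreal_def not_gr_zero ennreal_less_zero_iff less_top zero_le order_le_less_trans)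
  obtain k where k: "l < 2 ^ k" using real_arch_pow[of 2 l] by auto
  have "2 \<le> E (ennreal (x k)) * ennreal (m k)" using m(3)[of k] by (simp add: mult.commute)
  also have "\<dots> = (\<integral>\<^sup>+t. E (ennreal (x k)) * indicator (I k) t \<partial>lborel)"
    by (simp add: nn_integral_cmult_indicator I_meas)
  also have "\<dots> \<le> (\<integral>\<^sup>+t. E (ennreal (\<bar>f t\<bar> / l)) \<partial>lebesgue_on {0<..})"
    unfolding nn_integral_lebesgue_on_positive
  proof (intro nn_integral_mono)
    fix t :: real
    have "E (ennreal (x k)) \<le> E (ennreal (\<bar>f t\<bar> / l))" if "t \<in> I k"
    proof -
      have "(2::real) ^ k \<le> 2 ^ (k + 2)" by (intro power_increasing) auto
      then have "l \<le> 2 ^ (k + 2)" using k by linarith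
      then have "x k * l \<le> v k" using x(1)[of k] by (simp add: v_def mult.commute mult_left_mono del: power_add)
      then have "x k \<le> \<bar>f t\<bar> / l" using l(2) v0[of k] by (simp add: f_eq[OF that] le_divide_eq)
      then show ?thesis by (intro monoD[OF E] ennreal_leI)
    qed
    moreover have "0 < t" if "t \<in> I k" using that s0[of k] by (auto simp: I_def)
    ultimately show "E (ennreal (x k)) * indicator (I k) t \<le> E (ennreal (\<bar>f t\<bar> / l)) * indicator {0<..} t"
      by (auto split: split_indicator)
  qed
  also have "\<dots> \<le> 1" by (rule orlicz_norm_less_modular[OF E l(1)])
  finally show False by simp
qed

section \<open>The smallest target\<close>

text \<open>Otherwise the weighted sum of thresholds at points where \<open>B\<close> exceeds \<open>D (8 ^ (k + 1) * y k)\<close> is a target whose space does not contain \<open>L\<^sup>D\<close>. The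
factor \<open>8 = 2 * 4\<close> leaves \<open>2 ^ (k + 1)\<close> for the weights and \<open>4 ^ (k + 1)\<close> to overtake any dilation constant \<open>K\<close>.\<close>
lemma B_fun_le_smallest_target:
  assumes A: "quasi_convex A" and D: "quasi_convex D" and small: "smallest_laplace_target A D"
  obtains K where "0 < K" "\<And>x. 0 < x \<Longrightarrow> B_fun A (ennreal x) \<le> D (ennreal (K * x))"
proof (rule ccontr)
  assume no: "\<not> thesis"
  have bounded: "laplace_bounded A D" using small by (simp add: smallest_laplace_target_def)
  have "\<exists>y r. 0 < y \<and> 0 < r \<and> D (ennreal (8 ^ Suc k * y)) < ennreal r \<and> ennreal r \<le> B_fun A (ennreal y)" for k
  proof -
    have "\<exists>y>0. D (ennreal (8 ^ Suc k * y)) < B_fun A (ennreal y)"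
    proof (rule ccontr)
      assume "\<not> ?thesis"
      then have "\<And>y. 0 < y \<Longrightarrow> B_fun A (ennreal y) \<le> D (ennreal (8 ^ Suc k * y))" by (meson not_less)
      then show False using no that[of "8 ^ Suc k"] by simp
    qed
    then obtain y b where y: "0 < y" and b: "D (ennreal (8 ^ Suc k * y)) < b" "b < B_fun A (ennreal y)"
      using dense by blast
    have "0 < b" using b(1) by (rule le_less_trans[OF zero_le])
    then obtain r where "b = ennreal r" "0 < r" using b(2) by (cases b) auto
    then show ?thesis using y b by (intro exI[of _ y] exI[of _ r]) auto
  qed
  then obtain y R where yR: "\<And>k. 0 < y k" "\<And>k. 0 < R k"
      "\<And>k. D (ennreal (8 ^ Suc k * y k)) < ennreal (R k)" "\<And>k. ennreal (R k) \<le> B_fun A (ennreal (y k))"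
    by metis
  define E where "E = threshold_sum y R"
  obtain x\<^sub>1 where x1: "0 < x\<^sub>1" "B_fun A (ennreal x\<^sub>1) \<noteq> \<infinity>" by (rule B_fun_finite_somewhere[OF A])
  have "threshold_sum y R (ennreal x\<^sub>1) \<le> B_fun A (ennreal x\<^sub>1)"
    by (rule threshold_sum_le_B_fun) (rule yR x1)+
  then have "threshold_sum y R (ennreal x\<^sub>1) \<noteq> \<infinity>" using x1(2) by (auto simp: top_unique)
  then have E: "quasi_convex E"
    unfolding E_def by (intro quasi_convex_threshold_sum[of y R x\<^sub>1] yR(1,2) x1(1))
  have "G_fun A (ennreal (1 / y k)) \<le> ennreal (1 / R k)" for k
    using yR(4)[of k] le_B_fun_iff[of "R k" "y k" A, OF yR(2) yR(1)] by simp
  then have "laplace_bounded A E"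
    using bounded laplace_threshold_sum_estimate[OF A yR(1,2)]
    unfolding laplace_bounded_def E_def by (intro conjI exI[of _ 8]) auto
  then have "orlicz_space D \<subseteq> orlicz_space E"
    using small E by (simp add: smallest_laplace_target_def)
  then obtain K where K: "0 < K" "\<And>x. 0 < x \<Longrightarrow> E (ennreal x) \<le> D (ennreal (K * x))"
    using orlicz_space_subset_imp_dilate[OF D quasi_convex_mono[OF E]] by blast
  obtain k where k: "K < 4 ^ k" using real_arch_pow[of 4 K] by auto
  have "ennreal (R k) \<le> E (ennreal (2 ^ Suc k * y k))"
    unfolding E_def by (rule threshold_sum_lower) (rule yR)+
  also have "\<dots> \<le> D (ennreal (K * (2 ^ Suc k * y k)))" using yR(1)[of k] by (intro K) simp
  also have "\<dots> \<le> D (ennreal (8 ^ Suc k * y k))"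
  proof (intro monoD[OF quasi_convex_mono[OF D]] ennreal_leI)
    have "(4::real) ^ k \<le> 4 ^ Suc k" by (intro power_increasing) auto
    then have "K \<le> 4 ^ Suc k" using k by linarith
    then have "K * 2 ^ Suc k \<le> 4 ^ Suc k * 2 ^ Suc k" by (rule mult_right_mono) simp
    also have "\<dots> = (8::real) ^ Suc k" by (simp only: power_mult_distrib[symmetric]) simp
    finally have "K * 2 ^ Suc k * y k \<le> 8 ^ Suc k * y k" using yR(1)[of k] by (intro mult_right_mono) auto
    then show "K * (2 ^ Suc k * y k) \<le> 8 ^ Suc k * y k" by (simp only: mult.assoc)
  qed
  finally show False using yR(3)[of k] by simp
qed

theorem theorem5p6:
  fixes A :: "ennreal \<Rightarrow> ennreal"
  assumes "young_function A"
  shows "(log_condition A \<longrightarrow>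
            (quasi_convex (left_version (B_fun A)) \<and>
             (\<forall>f. orlicz_norm (left_version (B_fun A)) f = orlicz_norm (B_fun A) f) \<and>
             (quasi_convex (B_fun A) \<longleftrightarrow>
                (\<forall>t<\<infinity>. G_fun A t < \<infinity> \<longrightarrow> (\<exists>s>t. G_fun A s < \<infinity>)))) \<and>
            (laplace_bounded A (B_fun A) \<longleftrightarrow> smallest_laplace_target A (B_fun A)) \<and>
            (smallest_laplace_target A (B_fun A) \<longleftrightarrow>
               (\<exists>B. quasi_convex B \<and> smallest_laplace_target A B))) \<and>
         (\<not> log_condition A \<longrightarrow>
            \<not> (\<exists>B. quasi_convex B \<and> laplace_bounded A B))"
proof (intro conjI impI)
  have A: "quasi_convex A" using assms by (simp add: young_function_def)
  let ?B = "left_version (B_fun A)"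
  have norm: "orlicz_norm ?B f = orlicz_norm (B_fun A) f" for f
    by (rule orlicz_norm_left_version[OF mono_B_fun B_fun_zero[OF A]])
  then show "\<forall>f. orlicz_norm ?B f = orlicz_norm (B_fun A) f" ..
  have space: "orlicz_space ?B = orlicz_space (B_fun A)" by (simp add: orlicz_space_def norm)
  have bounded: "laplace_bounded A ?B \<longleftrightarrow> laplace_bounded A (B_fun A)" by (simp add: laplace_bounded_def norm)
  show "\<not> (\<exists>B. quasi_convex B \<and> laplace_bounded A B)" if "\<not> log_condition A"
    using that laplace_target_imp_log_condition[OF A] by blast
  assume "log_condition A"
  then obtain u where u: "0 < u" "G_fun A (ennreal u) < \<infinity>"
    using log_condition_iff_G_fun_finite[OF A] by blast
  show B: "quasi_convex ?B" by (rule quasi_convex_left_version_B_fun[OF A u])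
  show "quasi_convex (B_fun A) \<longleftrightarrow> (\<forall>t<\<infinity>. G_fun A t < \<infinity> \<longrightarrow> (\<exists>s>t. G_fun A s < \<infinity>))"
    by (rule quasi_convex_B_fun_iff[OF A u])
  have minimal: "orlicz_space (B_fun A) \<subseteq> orlicz_space D" if D: "quasi_convex D" "laplace_bounded A D" for D
  proof -
    obtain C where C: "0 < C" "\<And>y. 0 < y \<Longrightarrow> D (ennreal y) \<le> B_fun A (ennreal (C * y))"
      using laplace_target_le_B_fun[OF A D] by blast
    show ?thesis by (rule orlicz_space_dilate[of C D, OF C(1) quasi_convex_zero[OF D(1)] C(2)])
  qed
  show iff: "laplace_bounded A (B_fun A) \<longleftrightarrow> smallest_laplace_target A (B_fun A)"
    using minimal B space by (auto simp: smallest_laplace_target_def)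
  show "smallest_laplace_target A (B_fun A) \<longleftrightarrow> (\<exists>B. quasi_convex B \<and> smallest_laplace_target A B)"
  proof
    assume "smallest_laplace_target A (B_fun A)"
    then have "smallest_laplace_target A ?B" by (simp add: smallest_laplace_target_def space bounded)
    then show "\<exists>B. quasi_convex B \<and> smallest_laplace_target A B" using B by blast
  next
    assume "\<exists>B. quasi_convex B \<and> smallest_laplace_target A B"
    then obtain D where D: "quasi_convex D" "smallest_laplace_target A D" by blast
    obtain K where K: "0 < K" "\<And>x. 0 < x \<Longrightarrow> B_fun A (ennreal x) \<le> D (ennreal (K * x))"
      using B_fun_le_smallest_target[OF A D] by blast
    have "laplace_bounded A D" using D(2) by (simp add: smallest_laplace_target_def)
    then have "laplace_bounded A (B_fun A)"
      by (rule laplace_bounded_dilate[of A D K "B_fun A", OF _ K(1) B_fun_zero[OF A] K(2)])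
    then show "smallest_laplace_target A (B_fun A)" by (simp only: iff)
  qed
qed

end
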